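(* Let $D$ be a weighted oriented graph with no cycles sharing a path, such that each edge of every cycle of $D$ is incident to a vertex of degree $2$ in $D$. Assume that for any pairwise distinct cycles $\mathcal{C}_1,\mathcal{C}_2,\mathcal{C}_3$ in $D$ such that, for $i=1,2$, $\mathcal{C}_i$ is connected to $\mathcal{C}_3$ by a path $P_i$, every edge $e\in E(P_1)\cap E(P_2)$ satisfies one of the following conditions: (i) $e$ is incident to a vertex of degree $2$ in $D$; or (ii) $\mathcal{C}_3$ shares no vertex with any other cycle in $D$, and $\mathcal{C}_3$ is not connected to another cycle in $D$ by any path $P$ with $e\notin E(P)$. Then the toric ideal $I_D$ is strongly robust.
   Context: A weighted oriented graph is a triple $D=(V(D),E(D),w)$, where $V(D)=\{x_1,\ldots,x_n\}$ is a finite vertex set, $E(D)$ is a set of directed edges $(x_i,x_j)$ (directed from $x_i$ to $x_j$) whose underlying undirected graph has no loops and no multiple edges, and $w$ assigns to each vertex $x_j$ a positive integer weight $w_j=w(x_j)$. The degree of a vertex is the number of edges incident to it, inward or outward. Cycles and paths in $D$ are cycles and paths of the underlying undirected graph (edges may be oriented in any direction). "No cycles sharing a path" means that no two distinct cycles have a common path of length at least $1$, i.e. no two distinct cycles have a common edge. Two cycles $\mathcal{C},\mathcal{C}'$ are connected by a path $P$ if $P$ is a path with one endpoint on $\mathcal{C}$ and the other endpoint on $\mathcal{C}'$; such a path is allowed to pass through vertices of other cycles. $E(P)$ is the edge set of $P$. Let $K$ be a field. Writing $E(D)=\{e_1,\ldots,e_m\}$ and regarding the edges also as variables, the toric ideal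 $I_D$ is the kernel of the $K$-algebra homomorphism $K[e_1,\ldots,e_m]\to K[x_1,\ldots,x_n]$ sending the edge $(x_i,x_j)$ to $x_ix_j^{w_j}$. A nonzero binomial $\mathbf{e}^{\mathbf{u}}-\mathbf{e}^{\mathbf{v}}$ in a toric ideal $I$ is primitive if there is no other nonzero binomial $\mathbf{e}^{\mathbf{u}'}-\mathbf{e}^{\mathbf{v}'}\in I$ with $\mathbf{e}^{\mathbf{u}'}\mid\mathbf{e}^{\mathbf{u}}$ and $\mathbf{e}^{\mathbf{v}'}\mid\mathbf{e}^{\mathbf{v}}$. The Graver basis of $I$ is the set of all primitive binomials of $I$, where $f$ and $-f$ are identified. The toric ideal $I$ is strongly robust if its Graver basis is a minimal generating set of $I$ (equivalently, if the Graver basis equals the set of indispensable binomials of $I$, i.e. binomials $f\in I$ such that every system of binomial generators of $I$ contains $f$ or $-f$). *)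

theory Defs
  imports
    "Graph_Theory.Digraph_Component"
    "HOL-Algebra.RingHom"
    "HOL-Library.Poly_Mapping"
begin

section \<open>Weighted oriented graphs\<close>

text \<open>
  Arcs are ordered pairs, so the underlying undirected graph has no multiple edges exactly if
  no two arcs are opposite to each other.
\<close>

locale weighted_oriented_graph = pair_digraph D
  for D :: "'v pair_pre_digraph" +
  fixes w :: "'v \<Rightarrow> nat"
  assumes no_opposite_arcs: "(x, y) \<in> parcs D \<Longrightarrow> (y, x) \<notin> parcs D"
    and weight_pos: "x \<in> pverts D \<Longrightarrow> 0 < w x"

definition vertex_degree :: "'v pair_pre_digraph \<Rightarrow> 'v \<Rightarrow> nat" where
  "vertex_degree D x = in_degree D x + out_degree D x"

definition incident_to_degree_2 :: "'v pair_pre_digraph \<Rightarrow> 'v \<times> 'v \<Rightarrow> bool" where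
  "incident_to_degree_2 D e \<longleftrightarrow> (\<exists>x \<in> {fst e, snd e}. vertex_degree D x = 2)"

text \<open>
  Paths and cycles of the underlying undirected graph are taken in the symmetric closure
  \<^term>\<open>mk_symmetric D\<close>; their edges are translated back to edges of \<^term>\<open>D\<close>, forgetting
  the direction of traversal.
\<close>

definition traversed_edges :: "'v pair_pre_digraph \<Rightarrow> ('v \<times> 'v) awalk \<Rightarrow> ('v \<times> 'v) set" where
  "traversed_edges D p = {e \<in> parcs D. e \<in> set p \<or> prod.swap e \<in> set p}"

text \<open>
  A cycle is represented by its edge set, so that different choices of starting point and
  direction give the same cycle.  The length bound excludes the closed walks \<open>a, b, a\<close>, which
  \<^const>\<open>pre_digraph.cycle\<close> admits in a symmetric digraph.
\<close>

definition is_cycle :: "'v pair_pre_digraph \<Rightarrow> ('v \<times> 'v) set \<Rightarrow> bool" where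
  "is_cycle D C \<longleftrightarrow>
     (\<exists>p. pre_digraph.cycle (mk_symmetric D) p \<and> 3 \<le> length p \<and> C = traversed_edges D p)"

definition verts_of :: "('v \<times> 'v) set \<Rightarrow> 'v set" where
  "verts_of C = fst ` C \<union> snd ` C"

definition connecting_path ::
    "'v pair_pre_digraph \<Rightarrow> ('v \<times> 'v) set \<Rightarrow> ('v \<times> 'v) awalk \<Rightarrow> ('v \<times> 'v) set \<Rightarrow> bool" where
  "connecting_path D C P C' \<longleftrightarrow>
     (\<exists>u \<in> verts_of C. \<exists>v \<in> verts_of C'. pre_digraph.apath (mk_symmetric D) u P v)"


section \<open>Polynomial rings\<close>

text \<open>
  Polynomials over \<open>'k\<close> in variables of type \<open>'x\<close>: a power product is a finitely supported
  exponent vector, a polynomial a finitely supported family of coefficients.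
\<close>

type_synonym ('x, 'k) mpoly = "('x \<Rightarrow>\<^sub>0 nat) \<Rightarrow>\<^sub>0 'k"

definition const :: "'k::zero \<Rightarrow> ('x, 'k) mpoly" where
  "const c = Poly_Mapping.single 0 c"

definition monomial :: "('x \<Rightarrow>\<^sub>0 nat) \<Rightarrow> ('x, 'k::zero_neq_one) mpoly" where
  "monomial u = Poly_Mapping.single u 1"

definition variable :: "'x \<Rightarrow> ('x, 'k::zero_neq_one) mpoly" where
  "variable x = monomial (Poly_Mapping.single x 1)"

definition poly_ring :: "'x set \<Rightarrow> ('x, 'k::comm_ring_1) mpoly ring" where
  "poly_ring X =
     \<lparr> carrier = {p. \<forall>u \<in> Poly_Mapping.keys p. Poly_Mapping.keys u \<subseteq> X},
       mult = (*), one = 1, zero = 0, add = (+) \<rparr>"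

text \<open>The homomorphism of \<open>'k\<close>-algebras that sends each variable \<open>x\<close> to \<open>\<sigma> x\<close>.\<close>

definition subst_hom :: "('x \<Rightarrow> ('y, 'k) mpoly) \<Rightarrow> ('x, 'k::comm_ring_1) mpoly \<Rightarrow> ('y, 'k) mpoly" where
  "subst_hom \<sigma> p =
     (\<Sum>u \<in> Poly_Mapping.keys p. const (Poly_Mapping.lookup p u) *
        (\<Prod>x \<in> Poly_Mapping.keys u. \<sigma> x ^ Poly_Mapping.lookup u x))"


section \<open>Toric ideals, Graver bases and strong robustness\<close>

definition toric_ideal ::
    "'v pair_pre_digraph \<Rightarrow> ('v \<Rightarrow> nat) \<Rightarrow> ('v \<times> 'v, 'k::field) mpoly set" where
  "toric_ideal D w =
     a_kernel (poly_ring (parcs D)) (poly_ring (pverts D))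
       (subst_hom (\<lambda>(x, y). variable x * variable y ^ w y))"

definition primitive_binomial :: "('x, 'k::field) mpoly set \<Rightarrow> ('x, 'k) mpoly \<Rightarrow> bool" where
  "primitive_binomial I f \<longleftrightarrow>
     (\<exists>u v. f = monomial u - monomial v \<and> f \<noteq> 0 \<and> f \<in> I \<and>
        \<not> (\<exists>u' v' g. g = monomial u' - monomial v' \<and> g \<noteq> 0 \<and> g \<in> I \<and> g \<noteq> f \<and>
             (monomial u' :: ('x, 'k) mpoly) dvd monomial u \<and>
             (monomial v' :: ('x, 'k) mpoly) dvd monomial v))"

text \<open>
  Identifying \<open>f\<close> with \<open>- f\<close>: a Graver basis contains exactly one member of each pair
  \<open>{f, - f}\<close> of primitive binomials.  It is unique up to signs.
\<close>

definition is_graver_basis :: "('x, 'k::field) mpoly set \<Rightarrow> ('x, 'k) mpoly set \<Rightarrow> bool" where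
  "is_graver_basis I S \<longleftrightarrow>
     (\<forall>g \<in> S. primitive_binomial I g) \<and>
     (\<forall>f. primitive_binomial I f \<longrightarrow> (\<exists>!g. g \<in> S \<and> (g = f \<or> g = - f)))"

lemma primitive_binomial_uminus:
  assumes "primitive_binomial I f" and "\<And>g. g \<in> I \<Longrightarrow> - g \<in> I"
  shows "primitive_binomial I (- f)"
proof -
  from assms(1) obtain u v where f: "f = monomial u - monomial v" "f \<noteq> 0" "f \<in> I"
    and prim: "\<And>u' v'. \<lbrakk>monomial u' - monomial v' \<noteq> (0::('a, 'b) mpoly);
        (monomial u' :: ('a, 'b) mpoly) - monomial v' \<in> I; monomial u' - monomial v' \<noteq> f;
        (monomial u' :: ('a, 'b) mpoly) dvd monomial u;
        (monomial v' :: ('a, 'b) mpoly) dvd monomial v\<rbrakk> \<Longrightarrow> False"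
    unfolding primitive_binomial_def by blast
  have "- f = monomial v - monomial u" "- f \<noteq> 0"
    using f by auto
  moreover have "- f \<in> I"
    by (rule assms(2)) (rule f(3))
  moreover have False
    if g: "g = monomial v' - monomial u'" "g \<noteq> 0" "g \<in> I" "g \<noteq> - f"
      "(monomial v' :: ('a, 'b) mpoly) dvd monomial v"
      "(monomial u' :: ('a, 'b) mpoly) dvd monomial u" for u' v' and g :: "('a, 'b) mpoly"
  proof (rule prim[of u' v'])
    have g': "monomial u' - monomial v' = - g" using g(1) by simp
    show "monomial u' - monomial v' \<noteq> (0::('a, 'b) mpoly)" using g' g(2) by simp
    show "(monomial u' :: ('a, 'b) mpoly) - monomial v' \<in> I" using g' g(3) assms(2) by simp
    show "monomial u' - monomial v' \<noteq> f" using g' g(4) by auto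
  qed (use g in auto)
  ultimately show ?thesis
    unfolding primitive_binomial_def by blast
qed

lemma ex_graver_basis:
  assumes "\<And>g. g \<in> I \<Longrightarrow> - g \<in> I"
  shows "\<exists>S. is_graver_basis I S"
proof -
  define rep :: "('a, 'b) mpoly \<Rightarrow> ('a, 'b) mpoly" where "rep f = (SOME g. g \<in> {f, - f})" for f
  have rep_in: "rep f \<in> {f, - f}" for f
    unfolding rep_def by (rule someI[of _ f]) simp
  have rep_uminus: "rep (- f) = rep f" for f
    unfolding rep_def by (simp add: insert_commute)
  let ?S = "rep ` {f. primitive_binomial I f}"
  have "primitive_binomial I g" if "g \<in> ?S" for g
  proof -
    from that obtain f where f: "primitive_binomial I f" "g = rep f" by blast
    with rep_in[of f] have "g = f \<or> g = - f" by simp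
    with f(1) primitive_binomial_uminus[OF f(1) assms] show ?thesis by metis
  qed
  moreover have "\<exists>!g. g \<in> ?S \<and> (g = f \<or> g = - f)" if "primitive_binomial I f" for f
  proof (rule ex1I[of _ "rep f"])
    show "rep f \<in> ?S \<and> (rep f = f \<or> rep f = - f)"
      using that rep_in[of f] by auto
    show "g = rep f" if g: "g \<in> ?S \<and> (g = f \<or> g = - f)" for g
    proof -
      from g obtain h where h: "g = rep h" by blast
      with rep_in[of h] have "h = g \<or> h = - g" by auto
      with g have "h = f \<or> h = - f" by auto
      with h rep_uminus show ?thesis by metis
    qed
  qed
  ultimately show ?thesis
    unfolding is_graver_basis_def by blast
qed

lemma subst_hom_uminus: "subst_hom \<sigma> (- p) = - subst_hom \<sigma> p"
  by (simp add: subst_hom_def const_def single_uminus sum_negf)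

lemma uminus_mem_toric_ideal:
  assumes "p \<in> toric_ideal D w"
  shows "- p \<in> toric_ideal D w"
  using assms by (simp add: toric_ideal_def a_kernel_def' poly_ring_def subst_hom_uminus)

lemma ex_graver_basis_toric_ideal: "\<exists>S. is_graver_basis (toric_ideal D w) S"
  by (rule ex_graver_basis) (rule uminus_mem_toric_ideal)

definition minimal_generating_set :: "('a, 'm) ring_scheme \<Rightarrow> 'a set \<Rightarrow> 'a set \<Rightarrow> bool" where
  "minimal_generating_set R I S \<longleftrightarrow>
     S \<subseteq> carrier R \<and> genideal R S = I \<and> (\<forall>T. T \<subset> S \<longrightarrow> genideal R T \<noteq> I)"

text \<open>
  The choice of signs affects neither generation nor minimality.  The quantification is not
  vacuous: see \<open>ex_graver_basis_toric_ideal\<close>.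
\<close>

definition strongly_robust ::
    "('x, 'k::field) mpoly ring \<Rightarrow> ('x, 'k) mpoly set \<Rightarrow> bool" where
  "strongly_robust R I \<longleftrightarrow> (\<forall>S. is_graver_basis I S \<longrightarrow> minimal_generating_set R I S)"

end

theory Submission
  imports Defs
begin

text \<open>
  Exponent vectors \<open>u\<close>, \<open>v\<close> of a binomial in the toric ideal differ by an integer vector in the
  kernel of the weighted incidence matrix, and strong robustness reduces to the following: if
  \<open>c\<close> and \<open>g\<close> are kernel vectors such that the positive part of \<open>g\<close> is bounded by that of \<open>c\<close>,
  then so is the negative part.  At an edge with an end of degree 2, the balance equation there
  couples the edge to a single other one of opposite sign, which gives the bound.  Any other edge
  \<open>e\<close> with \<open>g e < 0\<close> lies on no cycle, hence is a bridge.  Supports of kernel vectors have no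
  leaves, so both sides of \<open>e\<close> contain cycles, and by the assumption on connecting paths one of the
  two sides contains only one cycle.  On that side the kernel vectors are proportional to each
  other, and the factor by which \<open>c\<close> exceeds \<open>g\<close> is at least 1 because of a positive value of \<open>g\<close>
  next to \<open>e\<close>.
\<close>

section \<open>Polynomials and toric ideals\<close>

lemma monomial_0 [simp]: "monomial 0 = 1"
  by (simp add: monomial_def)

lemma monomial_add: "monomial (u + v) = monomial u * (monomial v :: ('x, 'k::comm_ring_1) mpoly)"
  by (simp add: monomial_def mult_single)

lemma monomial_eq_iff [simp]:
  "monomial u = (monomial v :: ('x, 'k::zero_neq_one) mpoly) \<longleftrightarrow> u = v"
  by (metis keys_single monomial_def singleton_insert_inj_eq zero_neq_one)

lemma keys_monomial [simp]: "Poly_Mapping.keys (monomial u :: ('x, 'k::zero_neq_one) mpoly) = {u}"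
  by (simp add: monomial_def)

lemma lookup_monomial:
  "Poly_Mapping.lookup (monomial u :: ('x, 'k::zero_neq_one) mpoly) v = (if u = v then 1 else 0)"
  by (simp add: monomial_def lookup_single when_def)

lemma keys_binomial:
  assumes "u \<noteq> v"
  shows "Poly_Mapping.keys (monomial u - monomial v :: ('x, 'k::comm_ring_1) mpoly) = {u, v}"
  using assms by (auto simp: in_keys_iff lookup_minus lookup_monomial split: if_splits)

lemma monomial_dvd_iff:
  "(monomial u :: ('x, 'k::comm_ring_1) mpoly) dvd monomial v \<longleftrightarrow> (\<exists>t. v = u + t)"
proof
  assume "(monomial u :: ('x, 'k) mpoly) dvd monomial v"
  then obtain q :: "('x, 'k) mpoly" where "monomial v = monomial u * q" by (elim dvdE)
  then have "v \<in> Poly_Mapping.keys (monomial u * q)"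
    by (metis insertI1 keys_monomial)
  also have "\<dots> \<subseteq> {a + b | a b. a \<in> Poly_Mapping.keys (monomial u :: ('x, 'k) mpoly) \<and> b \<in> Poly_Mapping.keys q}"
    by (rule keys_mult)
  finally show "\<exists>t. v = u + t" by auto
qed (auto simp: monomial_add)

lemma exponent_dvd_iff:
  fixes u v :: "'x \<Rightarrow>\<^sub>0 nat"
  shows "(\<exists>t. v = u + t) \<longleftrightarrow> (\<forall>x. Poly_Mapping.lookup u x \<le> Poly_Mapping.lookup v x)"
proof
  assume "\<forall>x. Poly_Mapping.lookup u x \<le> Poly_Mapping.lookup v x"
  then have "v = u + (v - u)"
    by (intro poly_mapping_eqI) (simp add: lookup_add lookup_minus)
  then show "\<exists>t. v = u + t" ..
qed (auto simp: lookup_add)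

lemma keys_add_exponent:
  fixes u v :: "'x \<Rightarrow>\<^sub>0 nat"
  shows "Poly_Mapping.keys (u + v) = Poly_Mapping.keys u \<union> Poly_Mapping.keys v"
  by (auto simp: in_keys_iff lookup_add)

lemma poly_mapping_sum_singles:
  "p = (\<Sum>u\<in>Poly_Mapping.keys p. Poly_Mapping.single u (Poly_Mapping.lookup p u))"
  by (rule poly_mapping_eqI)
    (auto simp: lookup_sum lookup_single when_def in_keys_iff)

lemma lookup_const_mult:
  "Poly_Mapping.lookup (const c * p) u = c * Poly_Mapping.lookup p (u :: 'x \<Rightarrow>\<^sub>0 nat)"
  for c :: "'k::comm_ring_1"
proof -
  have "const c * p = Poly_Mapping.map ((*) c) p"
    by (simp add: mult_map_scale_conv_mult const_def)
  then show ?thesis by (simp add: Poly_Mapping.map.rep_eq when_def)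
qed

section \<open>The polynomial ring and its ideals\<close>

lemma poly_ring_simps:
  "p \<in> carrier (poly_ring X) \<longleftrightarrow> (\<forall>u\<in>Poly_Mapping.keys p. Poly_Mapping.keys u \<subseteq> X)"
  "p \<otimes>\<^bsub>poly_ring X\<^esub> q = p * q" "\<one>\<^bsub>poly_ring X\<^esub> = 1"
  "p \<oplus>\<^bsub>poly_ring X\<^esub> q = p + q" "\<zero>\<^bsub>poly_ring X\<^esub> = 0"
  by (auto simp: poly_ring_def)

lemma poly_ring_mult_closed:
  fixes p q :: "('x, 'k::comm_ring_1) mpoly"
  assumes "p \<in> carrier (poly_ring X)" "q \<in> carrier (poly_ring X)"
  shows "p * q \<in> carrier (poly_ring X)"
proof -
  have "Poly_Mapping.keys u \<subseteq> X" if u: "u \<in> Poly_Mapping.keys (p * q)" for u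
  proof -
    obtain a b where "u = a + b" "a \<in> Poly_Mapping.keys p" "b \<in> Poly_Mapping.keys q"
      using u keys_mult[of p q] by auto
    with assms show ?thesis by (auto simp: poly_ring_simps keys_add_exponent)
  qed
  then show ?thesis by (simp add: poly_ring_simps)
qed

lemma poly_ring_add_closed:
  fixes p q :: "('x, 'k::comm_ring_1) mpoly"
  assumes "p \<in> carrier (poly_ring X)" "q \<in> carrier (poly_ring X)"
  shows "p + q \<in> carrier (poly_ring X)"
  using assms Poly_Mapping.keys_add[of p q] by (auto simp: poly_ring_simps)

lemma poly_ring_uminus_closed:
  fixes p :: "('x, 'k::comm_ring_1) mpoly"
  assumes "p \<in> carrier (poly_ring X)"
  shows "- p \<in> carrier (poly_ring X)"
  using assms by (auto simp: poly_ring_simps in_keys_iff)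

lemma cring_poly_ring: "cring (poly_ring X :: ('x, 'k::comm_ring_1) mpoly ring)"
proof (rule cringI)
  show "abelian_group (poly_ring X :: ('x, 'k) mpoly ring)"
    by (rule abelian_groupI)
      (auto simp: poly_ring_simps(2-) poly_ring_simps(1)[of 0] add_ac
        intro: poly_ring_add_closed poly_ring_uminus_closed bexI[of _ "- _"])
  show "Group.comm_monoid (poly_ring X :: ('x, 'k) mpoly ring)"
    by (rule Group.comm_monoidI)
      (auto simp: poly_ring_simps(2-) poly_ring_simps(1)[of 1] mult_ac intro: poly_ring_mult_closed)
qed (simp add: poly_ring_simps distrib_right)

text \<open>Closure under negation follows from the last condition, as multiplication by the
  constant \<open>- 1\<close>.\<close>

lemma ideal_poly_ringI:
  fixes I :: "('x, 'k::comm_ring_1) mpoly set"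
  assumes "I \<subseteq> carrier (poly_ring X)" "0 \<in> I"
    and "\<And>p q. p \<in> I \<Longrightarrow> q \<in> I \<Longrightarrow> p + q \<in> I"
    and mult: "\<And>p q. p \<in> I \<Longrightarrow> q \<in> carrier (poly_ring X) \<Longrightarrow> q * p \<in> I"
  shows "ideal I (poly_ring X)"
proof -
  interpret cring "poly_ring X :: ('x, 'k) mpoly ring" by (rule cring_poly_ring)
  have "- p \<in> I" if "p \<in> I" for p
  proof -
    have "- 1 \<in> (carrier (poly_ring X) :: ('x, 'k) mpoly set)"
      by (rule poly_ring_uminus_closed) (simp add: poly_ring_simps)
    from mult[OF that this] show ?thesis by simp
  qed
  moreover have "\<ominus>\<^bsub>poly_ring X\<^esub> p = - p" if "p \<in> I" for p
  proof -
    have "p \<in> carrier (poly_ring X)" using that assms(1) by blast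
    then show ?thesis
      by (intro minus_equality) (simp_all add: poly_ring_simps(2-) poly_ring_uminus_closed)
  qed
  ultimately show ?thesis
    using assms
    by (intro idealI ring_axioms add.subgroupI)
      (auto simp: poly_ring_simps(2-) a_inv_def[symmetric] mult.commute)
qed

lemma ideal_poly_ringD:
  fixes I :: "('x, 'k::comm_ring_1) mpoly set"
  assumes "ideal I (poly_ring X)"
  shows "0 \<in> I" "\<And>p q. p \<in> I \<Longrightarrow> q \<in> I \<Longrightarrow> p + q \<in> I" "\<And>p. p \<in> I \<Longrightarrow> - p \<in> I"
    "\<And>p q. p \<in> I \<Longrightarrow> q \<in> carrier (poly_ring X) \<Longrightarrow> q * p \<in> I"
proof -
  interpret ideal I "poly_ring X" by fact
  show "0 \<in> I" "\<And>p q. p \<in> I \<Longrightarrow> q \<in> I \<Longrightarrow> p + q \<in> I"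
    using additive_subgroup.zero_closed[OF is_additive_subgroup]
      additive_subgroup.a_closed[OF is_additive_subgroup]
    by (auto simp: poly_ring_simps)
  show mult: "\<And>p q. p \<in> I \<Longrightarrow> q \<in> carrier (poly_ring X) \<Longrightarrow> q * p \<in> I"
    using I_l_closed by (auto simp: poly_ring_simps(2))
  show "- p \<in> I" if "p \<in> I" for p
  proof -
    have "- 1 \<in> (carrier (poly_ring X) :: ('x, 'k) mpoly set)"
      by (rule poly_ring_uminus_closed) (simp add: poly_ring_simps)
    from mult[OF that this] show ?thesis by simp
  qed
qed

section \<open>The toric map on exponent vectors\<close>

text \<open>These vectors are the columns of the weighted incidence matrix.\<close>

definition arc_exponent :: "('v \<Rightarrow> nat) \<Rightarrow> 'v \<times> 'v \<Rightarrow> 'v \<Rightarrow>\<^sub>0 nat" where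
  "arc_exponent w e = Poly_Mapping.single (fst e) 1 + Poly_Mapping.single (snd e) (w (snd e))"

text \<open>Multiplication by the incidence matrix. Multiples of a column are written as repeated
  sums, so that \<open>monomial_sum\<close> turns them directly into powers.\<close>

definition exponent_map :: "('v \<Rightarrow> nat) \<Rightarrow> ('v \<times> 'v \<Rightarrow>\<^sub>0 nat) \<Rightarrow> 'v \<Rightarrow>\<^sub>0 nat" where
  "exponent_map w u =
     (\<Sum>e\<in>Poly_Mapping.keys u. \<Sum>i<Poly_Mapping.lookup u e. arc_exponent w e)"

lemma lookup_exponent_map:
  assumes "finite E" "Poly_Mapping.keys u \<subseteq> E"
  shows "Poly_Mapping.lookup (exponent_map w u) v =
    (\<Sum>e\<in>E. Poly_Mapping.lookup u e * Poly_Mapping.lookup (arc_exponent w e) v)"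
proof -
  have "Poly_Mapping.lookup (exponent_map w u) v =
    (\<Sum>e\<in>Poly_Mapping.keys u. Poly_Mapping.lookup u e * Poly_Mapping.lookup (arc_exponent w e) v)"
    by (simp add: exponent_map_def lookup_sum)
  also have "\<dots> = (\<Sum>e\<in>E. Poly_Mapping.lookup u e * Poly_Mapping.lookup (arc_exponent w e) v)"
    using assms by (intro sum.mono_neutral_left) (auto simp: in_keys_iff)
  finally show ?thesis .
qed

lemma exponent_map_add: "exponent_map w (u + v) = exponent_map w u + exponent_map w v"
proof (rule poly_mapping_eqI)
  fix x
  let ?E = "Poly_Mapping.keys u \<union> Poly_Mapping.keys v"
  have "Poly_Mapping.keys (u + v) \<subseteq> ?E" by (simp add: keys_add_exponent)
  then show "Poly_Mapping.lookup (exponent_map w (u + v)) x =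
    Poly_Mapping.lookup (exponent_map w u + exponent_map w v) x"
    by (simp add: lookup_exponent_map[of ?E] lookup_add add_mult_distrib sum.distrib)
qed

text \<open>Every arc contributes exponent at least 1 at its tail, and nothing cancels among natural
  numbers. Hence no binomial of the toric ideal has exactly one constant side.\<close>

lemma exponent_map_eq_0_iff: "exponent_map w u = 0 \<longleftrightarrow> u = 0"
proof
  assume 0: "exponent_map w u = 0"
  show "u = 0"
  proof (rule poly_mapping_eqI, rule ccontr)
    fix e assume "Poly_Mapping.lookup u e \<noteq> Poly_Mapping.lookup 0 e"
    then have e: "e \<in> Poly_Mapping.keys u" by (simp add: in_keys_iff)
    have "Poly_Mapping.lookup (exponent_map w u) (fst e) = 0" by (simp add: 0)
    then have "Poly_Mapping.lookup u e * Poly_Mapping.lookup (arc_exponent w e) (fst e) = 0"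
      using e by (simp add: lookup_exponent_map[OF finite_keys subset_refl])
    with e show False by (simp add: arc_exponent_def lookup_add in_keys_iff)
  qed
qed (simp add: exponent_map_def)

lemma monomial_sum: "finite A \<Longrightarrow> (monomial (sum f A) :: ('x, 'k::comm_ring_1) mpoly) = (\<Prod>a\<in>A. monomial (f a))"
  by (induction A rule: finite_induct) (simp_all add: monomial_add)

lemma monomial_single_power:
  "monomial (Poly_Mapping.single x n) = (variable x :: ('x, 'k::comm_ring_1) mpoly) ^ n"
proof (induction n)
  case (Suc n)
  have "Poly_Mapping.single x (Suc n) = Poly_Mapping.single x 1 + Poly_Mapping.single x n"
    by (simp add: single_add[symmetric])
  with Suc show ?case by (simp add: monomial_add variable_def)
qed simp

abbreviation (input) arc_subst :: "('v \<Rightarrow> nat) \<Rightarrow> 'v \<times> 'v \<Rightarrow> ('v, 'k::comm_ring_1) mpoly" where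
  "arc_subst w \<equiv> (\<lambda>(x, y). variable x * variable y ^ w y)"

lemma arc_subst_eq: "(arc_subst w e :: ('v, 'k::comm_ring_1) mpoly) = monomial (arc_exponent w e)"
  using monomial_single_power[of "fst e" 1]
  by (cases e) (simp add: arc_exponent_def monomial_add monomial_single_power)

lemma subst_hom_eq:
  "(subst_hom (arc_subst w) p :: ('v, 'k::comm_ring_1) mpoly) =
     (\<Sum>u\<in>Poly_Mapping.keys p. Poly_Mapping.single (exponent_map w u) (Poly_Mapping.lookup p u))"
proof -
  have "(\<Prod>e\<in>Poly_Mapping.keys u. arc_subst w e ^ Poly_Mapping.lookup u e) =
    (monomial (exponent_map w u) :: ('v, 'k) mpoly)" for u
    unfolding exponent_map_def arc_subst_eq
    by (simp add: monomial_sum)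
  then show ?thesis
    by (simp add: subst_hom_def const_def monomial_def mult_single)
qed

text \<open>The coefficientwise form of the toric map: a polynomial of the ring lies in the toric
  ideal exactly if its coefficients add up to 0 over each fibre of
  \<open>exponent_map\<close>.\<close>

definition fibre_sum :: "('v \<Rightarrow> nat) \<Rightarrow> ('v \<times> 'v, 'k::comm_ring_1) mpoly \<Rightarrow> ('v \<Rightarrow>\<^sub>0 nat) \<Rightarrow> 'k" where
  "fibre_sum w p m = (\<Sum>u\<in>Poly_Mapping.keys p. if exponent_map w u = m then Poly_Mapping.lookup p u else 0)"

lemma lookup_subst_hom:
  "Poly_Mapping.lookup (subst_hom (arc_subst w) p :: ('v, 'k::comm_ring_1) mpoly) m = fibre_sum w p m"
  by (simp add: subst_hom_eq fibre_sum_def lookup_sum lookup_single when_def)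

lemma fibre_sum_superset:
  assumes "finite A" "Poly_Mapping.keys p \<subseteq> A"
  shows "fibre_sum w p m = (\<Sum>u\<in>A. if exponent_map w u = m then Poly_Mapping.lookup p u else 0)"
  unfolding fibre_sum_def
  using assms by (intro sum.mono_neutral_left) (auto simp: in_keys_iff)

lemma fibre_sum_add: "fibre_sum w (p + q) m = fibre_sum w p m + fibre_sum w q m"
proof -
  let ?A = "Poly_Mapping.keys p \<union> Poly_Mapping.keys q"
  have "Poly_Mapping.keys (p + q) \<subseteq> ?A" by (rule Poly_Mapping.keys_add)
  then show ?thesis
    by (simp add: fibre_sum_superset[of ?A] lookup_add sum.distrib[symmetric] if_distrib cong: if_cong)
qed

lemma fibre_sum_0 [simp]: "fibre_sum w 0 m = 0"
  by (simp add: fibre_sum_def)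

lemma fibre_sum_single [simp]:
  "fibre_sum w (Poly_Mapping.single u c) m = (if exponent_map w u = m then c else 0)"
  by (cases "c = 0") (auto simp: fibre_sum_def)

lemma subst_hom_add:
  "subst_hom (arc_subst w) (p + q) =
    (subst_hom (arc_subst w) p + subst_hom (arc_subst w) q :: ('v, 'k::comm_ring_1) mpoly)"
  by (rule poly_mapping_eqI) (simp add: lookup_subst_hom lookup_add fibre_sum_add)

lemma subst_hom_sum:
  "finite A \<Longrightarrow> subst_hom (arc_subst w) (sum f A) =
    (\<Sum>a\<in>A. subst_hom (arc_subst w) (f a) :: ('v, 'k::comm_ring_1) mpoly)"
proof (induction A rule: finite_induct)
  case empty
  then show ?case by (simp add: subst_hom_def)
qed (simp add: subst_hom_add)

lemma subst_hom_single:
  "subst_hom (arc_subst w) (Poly_Mapping.single u c) =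
    (Poly_Mapping.single (exponent_map w u) c :: ('v, 'k::comm_ring_1) mpoly)"
  by (rule poly_mapping_eqI) (simp add: lookup_subst_hom lookup_single when_def)

text \<open>Both factors are split into single terms, on which the map is governed by the additive
  \<open>exponent_map\<close>.\<close>

lemma subst_hom_mult:
  "subst_hom (arc_subst w) (p * q) =
    (subst_hom (arc_subst w) p * subst_hom (arc_subst w) q :: ('v, 'k::comm_ring_1) mpoly)"
proof -
  let ?h = "subst_hom (arc_subst w) :: _ \<Rightarrow> ('v, 'k) mpoly"
  let ?s = "\<lambda>p u. Poly_Mapping.single u (Poly_Mapping.lookup p u)"
  have "p * q = (\<Sum>u\<in>Poly_Mapping.keys p. \<Sum>v\<in>Poly_Mapping.keys q. ?s p u * ?s q v)"
    by (subst (1) poly_mapping_sum_singles, subst (2) poly_mapping_sum_singles) (rule sum_product)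
  then have "?h (p * q) = (\<Sum>u\<in>Poly_Mapping.keys p. \<Sum>v\<in>Poly_Mapping.keys q. ?h (?s p u) * ?h (?s q v))"
    by (simp add: subst_hom_sum subst_hom_single mult_single exponent_map_add)
  also have "\<dots> = ?h (\<Sum>u\<in>Poly_Mapping.keys p. ?s p u) * ?h (\<Sum>v\<in>Poly_Mapping.keys q. ?s q v)"
    by (simp only: subst_hom_sum finite_keys sum_product)
  finally show ?thesis
    by (simp only: poly_mapping_sum_singles[symmetric])
qed

lemma mem_toric_ideal_iff:
  "p \<in> toric_ideal D w \<longleftrightarrow>
     p \<in> carrier (poly_ring (parcs D)) \<and> (\<forall>m. fibre_sum w p m = 0)"
proof -
  have "subst_hom (arc_subst w) p = (0 :: ('a, 'b) mpoly) \<longleftrightarrow> (\<forall>m. fibre_sum w p m = 0)"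
    by (simp add: poly_mapping_eq_iff fun_eq_iff lookup_subst_hom)
  then show ?thesis
    by (simp add: toric_ideal_def a_kernel_def' poly_ring_simps)
qed

lemma mem_toric_ideal_subst_iff:
  "p \<in> toric_ideal D w \<longleftrightarrow>
     p \<in> carrier (poly_ring (parcs D)) \<and> subst_hom (arc_subst w) p = (0 :: ('v, 'k::field) mpoly)"
  for D :: "'v pair_pre_digraph"
  by (simp add: toric_ideal_def a_kernel_def' poly_ring_simps)

lemma ideal_toric_ideal: "ideal (toric_ideal D w :: ('v \<times> 'v, 'k::field) mpoly set) (poly_ring (parcs D))"
proof (rule ideal_poly_ringI)
  show "(0 :: ('v \<times> 'v, 'k) mpoly) \<in> toric_ideal D w"
    by (simp add: mem_toric_ideal_iff poly_ring_simps)
qed (auto simp: mem_toric_ideal_subst_iff subst_hom_add subst_hom_mult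
    intro: poly_ring_add_closed poly_ring_mult_closed)

text \<open>For \<open>u = v\<close> the binomial is 0 and carries no information on the variables
  in \<open>u\<close>, hence the hypothesis. For \<open>u \<noteq> v\<close> its only nonzero
  coefficients are 1 and \<open>- 1\<close>, so the fibre sums vanish exactly if both exponents
  share a fibre.\<close>

lemma binomial_mem_toric_ideal_iff:
  assumes "u \<noteq> v"
  shows "(monomial u - monomial v :: ('v \<times> 'v, 'k::field) mpoly) \<in> toric_ideal D w \<longleftrightarrow>
    Poly_Mapping.keys u \<subseteq> parcs D \<and> Poly_Mapping.keys v \<subseteq> parcs D \<and>
    exponent_map w u = exponent_map w v"
proof -
  have "(monomial u - monomial v :: ('v \<times> 'v, 'k) mpoly) =
    Poly_Mapping.single u 1 + Poly_Mapping.single v (- 1)"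
    by (simp add: monomial_def single_uminus)
  then have "fibre_sum w (monomial u - monomial v :: ('v \<times> 'v, 'k) mpoly) m =
    (if exponent_map w u = m then 1 else 0) - (if exponent_map w v = m then 1 else 0)" for m
    by (simp only: fibre_sum_add fibre_sum_single) simp
  then show ?thesis
    using assms by (auto simp: mem_toric_ideal_iff poly_ring_simps keys_binomial split: if_splits)
qed


section \<open>Generation by the Graver basis\<close>

definition total_degree :: "('x \<Rightarrow>\<^sub>0 nat) \<Rightarrow> nat" where
  "total_degree u = (\<Sum>x\<in>Poly_Mapping.keys u. Poly_Mapping.lookup u x)"

lemma total_degree_add: "total_degree (u + v) = total_degree u + total_degree v"
proof -
  let ?A = "Poly_Mapping.keys u \<union> Poly_Mapping.keys v"
  have *: "total_degree t = (\<Sum>x\<in>?A. Poly_Mapping.lookup t x)" if "Poly_Mapping.keys t \<subseteq> ?A" for t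
    unfolding total_degree_def using that
    by (intro sum.mono_neutral_left) (auto simp: in_keys_iff)
  show ?thesis
    using *[of u] *[of v] *[of "u + v"]
    by (simp add: keys_add_exponent lookup_add sum.distrib)
qed

lemma total_degree_eq_0_iff: "total_degree u = 0 \<longleftrightarrow> u = 0"
proof
  assume "total_degree u = 0"
  then show "u = 0"
    by (intro poly_mapping_eqI) (auto simp: total_degree_def in_keys_iff)
qed (simp add: total_degree_def)

text \<open>A binomial that is not primitive splits off a smaller binomial of the ideal, and what
  remains yields another one; induction on the total degree handles both. An arbitrary ideal
  \<open>J\<close> above \<open>S\<close> stands for the generated ideal, which is the intersection
  of all such \<open>J\<close>.\<close>

lemma binomial_mem_graver_ideal:
  fixes S :: "('v \<times> 'v, 'k::field) mpoly set"
  assumes graver: "is_graver_basis (toric_ideal D w) S"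
    and J: "ideal J (poly_ring (parcs D))" "S \<subseteq> J"
    and "exponent_map w u = exponent_map w v"
    and "Poly_Mapping.keys u \<subseteq> parcs D" "Poly_Mapping.keys v \<subseteq> parcs D"
  shows "monomial u - monomial v \<in> J"
  using assms(4-)
proof (induction "total_degree u + total_degree v" arbitrary: u v rule: less_induct)
  case less
  let ?I = "toric_ideal D w :: ('v \<times> 'v, 'k) mpoly set"
  let ?b = "\<lambda>u v. monomial u - monomial v :: ('v \<times> 'v, 'k) mpoly"
  show ?case
  proof (cases "u = v \<or> primitive_binomial ?I (?b u v)")
    case True
    then show ?thesis
    proof
      assume "primitive_binomial ?I (?b u v)"
      then obtain g where "g \<in> S" "g = ?b u v \<or> g = - ?b u v"
        using graver unfolding is_graver_basis_def by blast
      with J(2) ideal_poly_ringD(3)[OF J(1)] show ?thesis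
        by (metis add.inverse_inverse subsetD)
    qed (use ideal_poly_ringD(1)[OF J(1)] in simp)
  next
    case False
    then have "u \<noteq> v" by blast
    with less.prems have "?b u v \<in> ?I" "?b u v \<noteq> 0"
      by (simp_all add: binomial_mem_toric_ideal_iff)
    with False obtain u1 v1 where 1: "?b u1 v1 \<noteq> 0" "?b u1 v1 \<in> ?I" "?b u1 v1 \<noteq> ?b u v"
      "(monomial u1 :: ('v \<times> 'v, 'k) mpoly) dvd monomial u"
      "(monomial v1 :: ('v \<times> 'v, 'k) mpoly) dvd monomial v"
      unfolding primitive_binomial_def by blast
    then obtain u2 v2 where uv: "u = u1 + u2" "v = v1 + v2"
      by (auto simp: monomial_dvd_iff)
    have "u1 \<noteq> v1" using 1(1) by auto
    with 1(2) have e1: "exponent_map w u1 = exponent_map w v1"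
      by (simp add: binomial_mem_toric_ideal_iff)
    have e2: "exponent_map w u2 = exponent_map w v2"
      using less.prems(1) e1 by (simp add: uv exponent_map_add)
    have keys: "Poly_Mapping.keys u1 \<subseteq> parcs D" "Poly_Mapping.keys u2 \<subseteq> parcs D"
      "Poly_Mapping.keys v1 \<subseteq> parcs D" "Poly_Mapping.keys v2 \<subseteq> parcs D"
      using less.prems(2,3) by (auto simp: uv keys_add_exponent)
    \<comment> \<open>Both halves must be proper for the induction: the divisor is not the trivial
      pair, and the complement is not trivial because the divisor differs from the given
      binomial.\<close>
    have "u1 \<noteq> 0"
      using e1 \<open>u1 \<noteq> v1\<close> by (metis exponent_map_eq_0_iff)
    moreover have "u2 \<noteq> 0 \<or> v2 \<noteq> 0"
      using 1(3) by (auto simp: uv)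
    ultimately have "0 < total_degree u1" "0 < total_degree u2 + total_degree v2"
      using total_degree_eq_0_iff by fastforce+
    then have "?b u1 v1 \<in> J" "?b u2 v2 \<in> J"
      by (auto intro!: less.hyps e1 e2 keys simp: uv total_degree_add)
    moreover have "monomial t \<in> (carrier (poly_ring (parcs D)) :: ('v \<times> 'v, 'k) mpoly set)"
      if "Poly_Mapping.keys t \<subseteq> parcs D" for t
      using that by (simp add: poly_ring_simps)
    \<comment> \<open>The mixed monomial with exponent \<open>u2 + v1\<close> cancels between the
      two summands.\<close>
    ultimately have "monomial u2 * ?b u1 v1 + monomial v1 * ?b u2 v2 \<in> J"
      using keys ideal_poly_ringD(2,4)[OF J(1)] by blast
    also have "monomial u2 * ?b u1 v1 + monomial v1 * ?b u2 v2 = ?b u v"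
      by (simp add: uv monomial_add algebra_simps)
    finally show ?thesis .
  qed
qed

text \<open>A vanishing fibre sum forces each term \<open>u\<close> of \<open>p\<close> to share its
  fibre with a second term \<open>v\<close>. Subtracting a scalar multiple of that binomial removes
  \<open>u\<close> and introduces no new term, as \<open>v\<close> occurs already; so the number of
  terms drops.\<close>

lemma toric_ideal_subset_graver_ideal:
  fixes S :: "('v \<times> 'v, 'k::field) mpoly set"
  assumes graver: "is_graver_basis (toric_ideal D w) S"
    and J: "ideal J (poly_ring (parcs D))" "S \<subseteq> J"
  shows "p \<in> toric_ideal D w \<Longrightarrow> p \<in> J"
proof (induction "card (Poly_Mapping.keys p)" arbitrary: p rule: less_induct)
  case less
  let ?I = "toric_ideal D w :: ('v \<times> 'v, 'k) mpoly set"
  let ?l = "Poly_Mapping.lookup"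
  show ?case
  proof (cases "p = 0")
    case False
    then obtain u where u: "u \<in> Poly_Mapping.keys p"
      by (metis ex_in_conv keys_eq_empty)
    have "\<exists>v\<in>Poly_Mapping.keys p. v \<noteq> u \<and> exponent_map w v = exponent_map w u"
    proof (rule ccontr)
      assume neg: "\<not> ?thesis"
      have "fibre_sum w p (exponent_map w u) = ?l p u"
        unfolding fibre_sum_def
        by (subst sum.remove[OF finite_keys u], subst sum.neutral) (use neg in auto)
      with less.prems u show False by (simp add: mem_toric_ideal_iff in_keys_iff)
    qed
    then obtain v where v: "v \<in> Poly_Mapping.keys p" "v \<noteq> u" "exponent_map w v = exponent_map w u"
      by blast
    have keys: "Poly_Mapping.keys u \<subseteq> parcs D" "Poly_Mapping.keys v \<subseteq> parcs D"
      using less.prems u v by (auto simp: mem_toric_ideal_iff poly_ring_simps)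
    define b :: "('v \<times> 'v, 'k) mpoly" where "b = const (?l p u) * (monomial u - monomial v)"
    have const: "const (?l p u) \<in> carrier (poly_ring (parcs D))"
      by (auto simp: poly_ring_simps const_def)
    have bJ: "b \<in> J"
      unfolding b_def
      by (rule ideal_poly_ringD(4)[OF J(1) _ const])
        (use binomial_mem_graver_ideal[OF graver J v(3)[symmetric] keys] in simp)
    have bI: "b \<in> ?I"
      unfolding b_def
      by (rule ideal_poly_ringD(4)[OF ideal_toric_ideal _ const])
        (use v keys in \<open>auto simp: binomial_mem_toric_ideal_iff\<close>)
    have "p + - b \<in> ?I"
      using less.prems bI ideal_poly_ringD(2,3)[OF ideal_toric_ideal] by blast
    moreover have "Poly_Mapping.keys (p + - b) \<subset> Poly_Mapping.keys p"
    proof -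
      have l: "?l (p + - b) t = ?l p t - ?l p u * ((if u = t then 1 else 0) - (if v = t then 1 else 0))" for t
        by (simp add: b_def lookup_add lookup_const_mult lookup_minus lookup_monomial)
      have "?l (p + - b) u = 0" unfolding l using v(2) by simp
      moreover have "?l (p + - b) t = 0" if "?l p t = 0" for t
        unfolding l using that u v(1) by (auto simp: in_keys_iff)
      ultimately show ?thesis
        using u by (auto simp: in_keys_iff)
    qed
    ultimately have "p + - b \<in> J"
      using less.hyps by (simp add: psubset_card_mono)
    with bJ have "(p + - b) + b \<in> J"
      using ideal_poly_ringD(2)[OF J(1)] by blast
    then show ?thesis by simp
  qed (use ideal_poly_ringD(1)[OF J(1)] in simp)
qed

section \<open>Primitive binomials and minimality of the Graver basis\<close>

lemma binomial_eq_cases: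
  assumes "(monomial u - monomial v :: ('x, 'k::comm_ring_1) mpoly) = monomial u' - monomial v'"
    and "u \<noteq> v"
  shows "u = u' \<and> v = v' \<or> u = v' \<and> v = u'"
proof -
  have "u' \<noteq> v'"
    using assms by (metis eq_iff_diff_eq_0 monomial_eq_iff)
  with assms have "{u, v} = {u', v'}"
    by (metis keys_binomial)
  then show ?thesis by (simp add: doubleton_eq_iff)
qed

text \<open>
  In characteristic 2 the binomial does not determine the order of its two exponent vectors.
\<close>

lemma primitive_binomialD:
  fixes I :: "('x, 'k::field) mpoly set"
  assumes prim: "primitive_binomial I (monomial u - monomial v)"
    and uminus: "\<And>p. p \<in> I \<Longrightarrow> - p \<in> I"
    and uv': "monomial u' - monomial v' \<in> I" "u' \<noteq> v'"
    and le: "\<And>x. Poly_Mapping.lookup u' x \<le> Poly_Mapping.lookup u x"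
      "\<And>x. Poly_Mapping.lookup v' x \<le> Poly_Mapping.lookup v x"
  shows "monomial u' - monomial v' = (monomial u - monomial v :: ('x, 'k) mpoly)"
proof -
  let ?b = "\<lambda>u v. monomial u - monomial v :: ('x, 'k) mpoly"
  have dvd: "(monomial u' :: ('x, 'k) mpoly) dvd monomial u"
    "(monomial v' :: ('x, 'k) mpoly) dvd monomial v"
    using le by (simp_all add: monomial_dvd_iff exponent_dvd_iff)
  obtain a b where ab: "?b u v = ?b a b" "?b u v \<noteq> 0"
    and min: "\<And>a' b'. \<lbrakk>?b a' b' \<noteq> 0; ?b a' b' \<in> I; (monomial a' :: ('x, 'k) mpoly) dvd monomial a;
      (monomial b' :: ('x, 'k) mpoly) dvd monomial b\<rbrakk> \<Longrightarrow> ?b a' b' = ?b u v"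
    using prim unfolding primitive_binomial_def by blast
  have "u \<noteq> v" using ab(2) by auto
  with ab(1) consider "a = u" "b = v" | "a = v" "b = u"
    using binomial_eq_cases by metis
  then show ?thesis
  proof cases
    case 1
    with min[of u' v'] uv' dvd show ?thesis by simp
  next
    case 2
    \<comment> \<open>With the roles of the two exponents exchanged, minimality applies to the
      negated divisor, and the sign is undone afterwards.\<close>
    have "?b v' u' \<in> I"
      using uminus[OF uv'(1)] by simp
    with min[of v' u'] uv' dvd 2 have "?b v' u' = ?b v u" using ab(1) by simp
    then show ?thesis by (metis minus_diff_eq)
  qed
qed

lemma primitive_toric_binomialD:
  assumes "primitive_binomial (toric_ideal D w) (monomial u - monomial v :: ('v \<times> 'v, 'k::field) mpoly)"
  shows "u \<noteq> v" "exponent_map w u = exponent_map w v"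
    "Poly_Mapping.keys u \<subseteq> parcs D" "Poly_Mapping.keys v \<subseteq> parcs D"
proof -
  have *: "(monomial u - monomial v :: ('v \<times> 'v, 'k) mpoly) \<noteq> 0"
    "(monomial u - monomial v :: ('v \<times> 'v, 'k) mpoly) \<in> toric_ideal D w"
    using assms by (auto simp: primitive_binomial_def)
  show "u \<noteq> v" using *(1) by auto
  from *(2) show "exponent_map w u = exponent_map w v"
    "Poly_Mapping.keys u \<subseteq> parcs D" "Poly_Mapping.keys v \<subseteq> parcs D"
    unfolding binomial_mem_toric_ideal_iff[OF \<open>u \<noteq> v\<close>] by blast+
qed

text \<open>A variable dividing both monomials could be cancelled: \<open>exponent_map\<close> is
  additive, so the quotient stays in the ideal and contradicts primitivity. Thus \<open>u\<close>
  and \<open>v\<close> are the positive and negative part of their difference.\<close>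

lemma primitive_toric_binomial_disjoint:
  assumes prim: "primitive_binomial (toric_ideal D w) (monomial u - monomial v :: ('v \<times> 'v, 'k::field) mpoly)"
  shows "Poly_Mapping.lookup u e = 0 \<or> Poly_Mapping.lookup v e = 0"
proof (rule ccontr)
  assume neg: "\<not> ?thesis"
  let ?e = "Poly_Mapping.single e 1 :: 'v \<times> 'v \<Rightarrow>\<^sub>0 nat"
  note uv = primitive_toric_binomialD[OF prim]
  have "\<forall>x. Poly_Mapping.lookup ?e x \<le> Poly_Mapping.lookup u x"
    "\<forall>x. Poly_Mapping.lookup ?e x \<le> Poly_Mapping.lookup v x"
    using neg by (auto simp: lookup_single when_def)
  then obtain u' v' where uv': "u = ?e + u'" "v = ?e + v'"
    using exponent_dvd_iff by metis
  have "u' \<noteq> v'" using uv(1) uv' by auto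
  moreover have "(monomial u' - monomial v' :: ('v \<times> 'v, 'k) mpoly) \<in> toric_ideal D w"
    using uv by (simp add: binomial_mem_toric_ideal_iff[OF \<open>u' \<noteq> v'\<close>] uv' exponent_map_add
        keys_add_exponent)
  ultimately have "monomial u' - monomial v' = (monomial u - monomial v :: ('v \<times> 'v, 'k) mpoly)"
    by (intro primitive_binomialD[OF prim uminus_mem_toric_ideal])
      (simp_all add: uv' lookup_add)
  then have "u' = u \<and> v' = v \<or> u' = v \<and> v' = u"
    using binomial_eq_cases \<open>u' \<noteq> v'\<close> by blast
  \<comment> \<open>Comparing degrees also excludes the exchanged case, where each of
    \<open>u\<close> and \<open>v\<close> would have smaller degree than the other.\<close>
  moreover have "total_degree u' < total_degree u" "total_degree v' < total_degree v"
    unfolding uv' total_degree_add by (simp_all add: total_degree_def)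
  ultimately show False by auto
qed

text \<open>The hypothesis says that divisibility between primitive binomials on one side forces it
  on the other. If \<open>f\<close> were generated by the remaining elements of the Graver basis, a
  monomial of some such \<open>g\<close> would divide a monomial of \<open>f\<close>; divisibility
  on both sides and primitivity then give \<open>g = f\<close> up to sign.\<close>

lemma strongly_robust_toric_idealI:
  fixes D :: "'v pair_pre_digraph"
  assumes le: "\<And>u v u' v' e.
    \<lbrakk>primitive_binomial (toric_ideal D w) (monomial u - monomial v :: ('v \<times> 'v, 'k::field) mpoly);
     primitive_binomial (toric_ideal D w) (monomial u' - monomial v' :: ('v \<times> 'v, 'k) mpoly);
     \<And>e. Poly_Mapping.lookup u' e \<le> Poly_Mapping.lookup u e\<rbrakk> \<Longrightarrow>
     Poly_Mapping.lookup v' e \<le> Poly_Mapping.lookup v e"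
  shows "strongly_robust (poly_ring (parcs D)) (toric_ideal D w :: ('v \<times> 'v, 'k) mpoly set)"
  unfolding strongly_robust_def minimal_generating_set_def
proof (intro allI impI conjI)
  fix S T
  let ?I = "toric_ideal D w :: ('v \<times> 'v, 'k) mpoly set"
  let ?R = "poly_ring (parcs D) :: ('v \<times> 'v, 'k) mpoly ring"
  assume S: "is_graver_basis ?I S"
  have I_sub: "?I \<subseteq> carrier ?R" by (auto simp: mem_toric_ideal_iff)
  have "S \<subseteq> ?I"
    using S by (auto simp: is_graver_basis_def primitive_binomial_def)
  with I_sub show "S \<subseteq> carrier ?R" by blast
  show "genideal ?R S = ?I"
  proof
    show "genideal ?R S \<subseteq> ?I"
      using ideal_toric_ideal \<open>S \<subseteq> ?I\<close> by (auto simp: genideal_def)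
    show "?I \<subseteq> genideal ?R S"
      using toric_ideal_subset_graver_ideal[OF S] by (auto simp: genideal_def)
  qed
  assume "T \<subset> S"
  then obtain f where f: "f \<in> S" "f \<notin> T" by blast
  \<comment> \<open>a monomial ideal that contains \<open>T\<close> but not \<open>f\<close>\<close>
  define J where "J = {p \<in> carrier ?R. \<forall>m\<in>Poly_Mapping.keys p. \<exists>g\<in>T. \<exists>a\<in>Poly_Mapping.keys g. \<exists>t. m = a + t}"
  have "ideal J ?R"
  proof (rule ideal_poly_ringI)
    show "p + q \<in> J" if "p \<in> J" "q \<in> J" for p q
      using that Poly_Mapping.keys_add[of p q] poly_ring_add_closed by (fastforce simp: J_def)
    show "q * p \<in> J" if p: "p \<in> J" and q: "q \<in> carrier ?R" for p q
    proof -
      have "\<exists>g\<in>T. \<exists>a\<in>Poly_Mapping.keys g. \<exists>t. m = a + t"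
        if m: "m \<in> Poly_Mapping.keys (q * p)" for m
      proof -
        obtain b c where bc: "m = b + c" "c \<in> Poly_Mapping.keys p"
          using m keys_mult[of q p] by auto
        then obtain g a t where "g \<in> T" "a \<in> Poly_Mapping.keys g" "c = a + t"
          using p unfolding J_def by blast
        moreover from this have "m = a + (b + t)"
          by (simp add: bc add_ac)
        ultimately show ?thesis by blast
      qed
      with p q show ?thesis by (simp add: J_def poly_ring_mult_closed)
    qed
  qed (auto simp: J_def poly_ring_simps)
  moreover have "T \<subseteq> J"
    using \<open>T \<subset> S\<close> \<open>S \<subseteq> ?I\<close> I_sub by (auto simp: J_def intro!: bexI exI[of _ 0])
  ultimately have "genideal ?R T \<subseteq> J"
    by (auto simp: genideal_def)
  moreover have "f \<notin> J"
  proof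
    assume "f \<in> J"
    have prim: "primitive_binomial ?I f" using S f by (simp add: is_graver_basis_def)
    then obtain u v where uv: "f = monomial u - monomial v"
      by (auto simp: primitive_binomial_def)
    have "u \<noteq> v" using primitive_toric_binomialD(1) prim uv by blast
    then have "u \<in> Poly_Mapping.keys f" by (simp add: uv keys_binomial)
    then obtain g a t where g: "g \<in> T" "a \<in> Poly_Mapping.keys g" "u = a + t"
      using \<open>f \<in> J\<close> unfolding J_def by blast
    have prim_g: "primitive_binomial ?I g"
      using S g \<open>T \<subset> S\<close> by (auto simp: is_graver_basis_def)
    then obtain a' b' where ab: "g = monomial a' - monomial b'"
      by (auto simp: primitive_binomial_def)
    have "a' \<noteq> b'" using primitive_toric_binomialD(1) prim_g ab by blast
    then have "a = a' \<or> a = b'" using g(2) by (simp add: ab keys_binomial)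
    \<comment> \<open>The sign is chosen so that the monomial dividing \<open>u\<close> comes
      first.\<close>
    then obtain b where b: "g = monomial a - monomial b \<or> - g = monomial a - monomial b"
      using ab by auto
    have prim_ab: "primitive_binomial ?I (monomial a - monomial b)"
      using b prim_g primitive_binomial_uminus[OF prim_g uminus_mem_toric_ideal] by auto
    have le_u: "Poly_Mapping.lookup a e \<le> Poly_Mapping.lookup u e" for e
      by (simp add: g(3) lookup_add)
    have "monomial a - monomial b = f"
      unfolding uv
    proof (rule primitive_binomialD)
      show "primitive_binomial ?I (monomial u - monomial v)" using prim uv by simp
      show "monomial a - monomial b \<in> ?I"
        using prim_ab unfolding primitive_binomial_def by blast
      show "a \<noteq> b" using primitive_toric_binomialD(1)[OF prim_ab] .
      show "Poly_Mapping.lookup b e \<le> Poly_Mapping.lookup v e" for e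
        using le prim prim_ab le_u unfolding uv by blast
    qed (use le_u uminus_mem_toric_ideal in auto)
    with b have "g = f \<or> g = - f" by (metis add.inverse_inverse)
    \<comment> \<open>A Graver basis holds only one of \<open>f\<close> and \<open>- f\<close>, so
      the sign ambiguity disappears.\<close>
    moreover have "\<exists>!h. h \<in> S \<and> (h = f \<or> h = - f)"
      using S prim by (simp add: is_graver_basis_def)
    ultimately have "g = f" using f g \<open>T \<subset> S\<close> by blast
    with f g show False by blast
  qed
  ultimately show "genideal ?R T \<noteq> ?I"
    using f(1) \<open>S \<subseteq> ?I\<close> by blast
qed

section \<open>Kernel vectors and bridges\<close>

context weighted_oriented_graph
begin

section \<open>Kernel vectors of the weighted incidence matrix\<close>

abbreviation coef :: "'v \<times> 'v \<Rightarrow> 'v \<Rightarrow> nat" where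
  "coef e v \<equiv> Poly_Mapping.lookup (arc_exponent w e) v"

lemma coef_eq: "coef e v = (if fst e = v then 1 else 0) + (if snd e = v then w v else 0)"
  by (auto simp: arc_exponent_def lookup_add lookup_single when_def)

definition kernel_vector :: "('v \<times> 'v \<Rightarrow> int) \<Rightarrow> bool" where
  "kernel_vector h \<longleftrightarrow> (\<forall>v. (\<Sum>e\<in>parcs D. int (coef e v) * h e) = 0)"

definition supp :: "('v \<times> 'v \<Rightarrow> int) \<Rightarrow> ('v \<times> 'v) set" where
  "supp h = {e \<in> parcs D. h e \<noteq> 0}"

lemma kernel_vector_lin:
  assumes "kernel_vector g" "kernel_vector h"
  shows "kernel_vector (\<lambda>e. a * g e - b * h e)"
proof -
  have "(\<Sum>e\<in>parcs D. int (coef e v) * (a * g e - b * h e)) =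
    a * (\<Sum>e\<in>parcs D. int (coef e v) * g e) - b * (\<Sum>e\<in>parcs D. int (coef e v) * h e)" for v
    by (simp add: sum_distrib_left sum_subtractf algebra_simps)
  with assms show ?thesis by (simp add: kernel_vector_def)
qed

text \<open>Positivity of the weights enters here: the coefficient at the head of an arc is nonzero,
  like the one at its tail.\<close>

lemma coef_eq_0_iff: "e \<in> parcs D \<Longrightarrow> coef e v = 0 \<longleftrightarrow> v \<notin> {fst e, snd e}"
proof -
  assume "e \<in> parcs D"
  then have "0 < w (snd e)" using weight_pos arc_snd_in_verts by blast
  then show ?thesis by (auto simp: coef_eq)
qed

text \<open>All coefficients of the balance equation at \<open>v\<close> are nonnegative, so a
  negative term has to be compensated by a positive value of \<open>h\<close> at
  \<open>v\<close>.\<close>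

lemma ex_neighbour_pos:
  assumes h: "kernel_vector h" and e: "e \<in> parcs D" "h e < 0" and v: "v \<in> {fst e, snd e}"
  shows "\<exists>f \<in> parcs D. v \<in> {fst f, snd f} \<and> h f > 0"
proof (rule ccontr)
  assume neg: "\<not> ?thesis"
  have le: "int (coef f v) * h f \<le> 0" if "f \<in> parcs D" for f
  proof (cases "v \<in> {fst f, snd f}")
    case True
    with neg that have "h f \<le> 0" by force
    then show ?thesis by (simp add: mult_nonneg_nonpos)
  next
    case False
    with that have "coef f v = 0" using coef_eq_0_iff by blast
    then show ?thesis by simp
  qed
  moreover have "int (coef e v) * h e < 0"
    using e v coef_eq_0_iff[OF e(1), of v] by (simp add: mult_pos_neg)
  ultimately have "(\<Sum>f\<in>parcs D. int (coef f v) * h f) < (\<Sum>f\<in>parcs D. 0)"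
    using e(1) by (intro sum_strict_mono_ex1) (auto intro: pair_finite_arcs)
  with h show False by (simp add: kernel_vector_def)
qed

text \<open>Compensation of signs at \<open>v\<close>, applied to \<open>h\<close> or to its
  negative. It makes the support free of leaves.\<close>

lemma ex_other_supp_arc:
  assumes h: "kernel_vector h" and e: "e \<in> supp h" and v: "v \<in> {fst e, snd e}"
  shows "\<exists>f \<in> supp h. f \<noteq> e \<and> v \<in> {fst f, snd f}"
proof (cases "h e < 0")
  case True
  then show ?thesis
    using ex_neighbour_pos[OF h _ True v] e by (fastforce simp: supp_def)
next
  case False
  have "kernel_vector (\<lambda>e. - h e)"
    using kernel_vector_lin[OF h h, of 0 1] by simp
  from ex_neighbour_pos[OF this _ _ v] False e show ?thesis
    by (fastforce simp: supp_def)
qed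

section \<open>Cycles of the underlying undirected graph\<close>

lemma mk_symmetric_graph: "pair_graph (mk_symmetric D)"
proof -
  interpret S: pair_digraph "mk_symmetric D" by (rule digraph_mk_symmetric)
  show ?thesis by unfold_locales (rule symmetric_mk_symmetric)
qed

sublocale S: pair_graph "mk_symmetric D"
  by (rule mk_symmetric_graph)

lemma in_S_iff: "(a, b) \<in> parcs (mk_symmetric D) \<longleftrightarrow> (a, b) \<in> parcs D \<or> (b, a) \<in> parcs D"
  by (auto simp: parcs_mk_symmetric intro: bexI[of _ "(b, a)"])

lemma is_cycle_conv:
  "is_cycle D C \<longleftrightarrow> (\<exists>p u. S.awalk u p u \<and> distinct (tl (S.awalk_verts u p)) \<and>
     3 \<le> length p \<and> C = traversed_edges D p)"
proof -
  have "p \<noteq> []" if "3 \<le> length p" for p :: "('v \<times> 'v) list" using that by auto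
  then show ?thesis unfolding is_cycle_def S.cycle_def by blast
qed

text \<open>Among the paths in \<open>F\<close> that start with the step from \<open>a\<close> to
  \<open>b\<close>, a longest one is taken. Its end \<open>v\<close> is no leaf of \<open>F\<close>,
  and by maximality the further edge at \<open>v\<close> leads back to a vertex of the path, which
  closes a cycle through \<open>v\<close>.\<close>

lemma ex_cycle_beyond:
  assumes F: "F \<subseteq> parcs D"
    and other: "\<And>e v. e \<in> F \<Longrightarrow> v \<in> {fst e, snd e} \<Longrightarrow>
      \<exists>f \<in> F. f \<noteq> e \<and> v \<in> {fst f, snd f}"
    and ab: "(a, b) \<in> F \<union> F\<inverse>"
  shows "\<exists>K p v. is_cycle D K \<and> K \<subseteq> F \<and> v \<in> verts_of K \<and> S.apath a ((a, b) # p) v \<and>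
    set ((a, b) # p) \<subseteq> F \<union> F\<inverse>"
proof -
  define Q where "Q p \<longleftrightarrow> (\<exists>v. S.apath a ((a, b) # p) v) \<and> set ((a, b) # p) \<subseteq> F \<union> F\<inverse>" for p
  have FS: "F \<union> F\<inverse> \<subseteq> parcs (mk_symmetric D)"
    using F by (auto simp: in_S_iff)
  have "a \<noteq> b" using ab F no_loops' by auto
  then have "Q []"
    using ab FS S.wellformed' by (auto simp: Q_def S.apath_simps)
  moreover have "length p \<le> card (pverts (mk_symmetric D))" if "Q p" for p
    using that S.length_apath by (fastforce simp: Q_def)
  ultimately obtain p where p: "Q p" and max: "\<And>q. Q q \<Longrightarrow> length q \<le> length p"
    using ex_has_greatest_nat[of Q "[]" length "Suc (card (pverts (mk_symmetric D)))"]
    by (auto simp: less_Suc_eq_le)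
  define P where "P = (a, b) # p"
  obtain v where P: "S.apath a P v" and PF: "set P \<subseteq> F \<union> F\<inverse>"
    using p by (auto simp: Q_def P_def)
  obtain P' v' where P': "P = P' @ [(v', v)]"
  proof (cases P rule: rev_cases)
    case Nil
    then show ?thesis by (simp add: P_def)
  next
    case (snoc P' e)
    then have "e = (fst e, v)" using P
      by (auto simp: S.apath_append_iff S.apath_simps prod_eq_iff)
    then show ?thesis using snoc that by metis
  qed
  obtain f where f: "f \<in> F" "f = (v', v) \<or> f = (v, v')"
    using PF by (auto simp: P')
  have "v \<in> {fst f, snd f}" using f(2) by auto
  then obtain f' where f': "f' \<in> F" "f' \<noteq> f" "v \<in> {fst f', snd f'}"
    using other[OF f(1)] by blast
  obtain u where u: "(v, u) \<in> F \<union> F\<inverse>" "f' = (v, u) \<or> f' = (u, v)"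
    using f'(1,3) by (metis UnI1 UnI2 converse_iff insert_iff prod.collapse empty_iff)
  \<comment> \<open>Otherwise \<open>f\<close> and \<open>f'\<close> would be two opposite arcs
    between the same vertices.\<close>
  have "u \<noteq> v'"
  proof
    assume "u = v'"
    then have "(v, v') \<in> F \<and> (v', v) \<in> F"
      using f f'(1,2) u(2) by metis
    with F no_opposite_arcs show False by blast
  qed
  have "u \<noteq> v" using u(1) F no_loops' by auto
  have last: "last (S.awalk_verts a P) = v"
    using S.awalkI_apath[OF P] by auto
  have u_in: "u \<in> set (S.awalk_verts a P)"
  proof (rule ccontr)
    assume "u \<notin> set (S.awalk_verts a P)"
    moreover have "(v, u) \<in> parcs (mk_symmetric D)" using u(1) FS by blast
    ultimately have "S.apath a (P @ [(v, u)]) u"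
      unfolding S.apath_append_iff last
      using P \<open>u \<noteq> v\<close> S.wellformed' by (auto simp: S.apath_simps)
    then have "Q (p @ [(v, u)])"
      using u(1) PF unfolding Q_def P_def by auto
    with max show False by fastforce
  qed
  obtain q r where qr: "P = q @ r" and q: "S.awalk a q u" and r: "S.awalk u r v"
    using S.awalk_decomp[OF S.awalkI_apath[OF P] u_in] by blast
  have r_path: "S.apath u r v"
    using P q by (auto simp: qr S.apath_append_iff)
  \<comment> \<open>A single edge from \<open>u\<close> to \<open>v\<close> would be the last edge
    of \<open>P\<close>, whose tail is \<open>v'\<close>. The case rule at the end separates lists
    of length 0, 1 and at least 2. With the closing edge the length reaches 3.\<close>
  have len: "2 \<le> length r"
  proof -
    have "r \<noteq> []" using r \<open>u \<noteq> v\<close> by (auto simp: S.awalk_Nil_iff)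
    moreover have False if "r = [e]" for e
      using that r qr P' \<open>u \<noteq> v'\<close> by (auto simp: S.awalk_Cons_iff)
    ultimately show ?thesis by (cases r rule: remdups_adj.cases) auto
  qed
  define K where "K = traversed_edges D (r @ [(v, u)])"
  have vu: "(v, u) \<in> parcs (mk_symmetric D)" using u(1) FS by blast
  have "S.awalk u (r @ [(v, u)]) u"
    using r vu S.wellformed' by (auto simp: S.awalk_simps)
  moreover have "distinct (tl (S.awalk_verts u (r @ [(v, u)])))"
  proof -
    have "r \<noteq> []" using len by auto
    then have "snd (last r) = v"
      using S.awalkE[OF r] by (auto simp: S.awalk_verts_conv)
    with \<open>r \<noteq> []\<close> have "S.awalk_verts u (r @ [(v, u)]) = S.awalk_verts u r @ [u]"
      by (auto simp: S.awalk_verts_conv)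
    moreover obtain vs where "S.awalk_verts u r = u # vs"
      using S.awalkE[OF r] by (metis S.awalk_verts_non_Nil list.collapse)
    moreover have "distinct (S.awalk_verts u r)"
      using r_path by (simp add: S.apath_def)
    ultimately show ?thesis by simp
  qed
  moreover have "3 \<le> length (r @ [(v, u)])" using len by simp
  ultimately have "is_cycle D K"
    unfolding is_cycle_conv K_def by blast
  moreover have "K \<subseteq> F"
  proof -
    have "set (r @ [(v, u)]) \<subseteq> F \<union> F\<inverse>"
      using PF u(1) by (auto simp: qr)
    then show ?thesis
      using F no_opposite_arcs by (fastforce simp: K_def traversed_edges_def)
  qed
  moreover have "v \<in> verts_of K"
    using vu by (force simp: K_def verts_of_def traversed_edges_def in_S_iff)
  ultimately show ?thesis
    using P PF by (auto simp: P_def)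
qed

section \<open>Bridges and their two sides\<close>

text \<open>Connectivity after deletion of \<open>e\<close>, phrased by walks in the full symmetric
  graph so that only one graph is involved.\<close>

definition avoiding_walk :: "'v \<times> 'v \<Rightarrow> 'v \<Rightarrow> 'v \<Rightarrow> bool" where
  "avoiding_walk e a b \<longleftrightarrow> (\<exists>p. S.awalk a p b \<and> e \<notin> set p \<and> prod.swap e \<notin> set p)"

lemma avoiding_walk_trans:
  "avoiding_walk e a b \<Longrightarrow> avoiding_walk e b c \<Longrightarrow> avoiding_walk e a c"
  unfolding avoiding_walk_def by (metis S.awalk_appendI UnE set_append)

lemma set_rev_path: "set (rev_path p) = prod.swap ` set p"
  by (induction p) (auto simp: prod.swap_def)

lemma avoiding_walk_sym:
  assumes "avoiding_walk e a b" shows "avoiding_walk e b a"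
proof -
  obtain p where p: "S.awalk a p b" "e \<notin> set p" "prod.swap e \<notin> set p"
    using assms by (auto simp: avoiding_walk_def)
  have "S.awalk b (rev_path p) a" using p(1) by simp
  moreover have "e \<notin> set (rev_path p)" "prod.swap e \<notin> set (rev_path p)"
    using p(2,3) by (cases e; force simp: set_rev_path)+
  ultimately show ?thesis unfolding avoiding_walk_def by blast
qed

lemma avoiding_walk_swap: "avoiding_walk (prod.swap e) a b \<longleftrightarrow> avoiding_walk e a b"
  by (auto simp: avoiding_walk_def)

lemma avoiding_walk_apath:
  assumes "avoiding_walk e a b"
  obtains p where "S.apath a p b" "e \<notin> set p" "prod.swap e \<notin> set p"
proof -
  obtain p where p: "S.awalk a p b" "e \<notin> set p" "prod.swap e \<notin> set p"
    using assms by (auto simp: avoiding_walk_def)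
  then show ?thesis
    using that[of "S.awalk_to_apath p"] S.apath_awalk_to_apath S.awalk_to_apath_subset by blast
qed

lemma avoiding_walk_in_path:
  assumes "S.awalk a p b" "e \<notin> set p" "prod.swap e \<notin> set p" "v \<in> set (S.awalk_verts a p)"
  shows "avoiding_walk e a v"
proof -
  obtain q r where "p = q @ r" "S.awalk a q v"
    using S.awalk_decomp[OF assms(1,4)] by blast
  then show ?thesis using assms by (auto simp: avoiding_walk_def)
qed

text \<open>An edge on no cycle is a bridge: a path between its ends that avoids it would be closed
  by the edge to a cycle.\<close>

lemma not_avoiding_walk_ends:
  assumes e: "(x, y) \<in> parcs D \<or> (y, x) \<in> parcs D"
    and nocyc: "\<And>C. is_cycle D C \<Longrightarrow> (x, y) \<notin> C \<and> (y, x) \<notin> C"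
  shows "\<not> avoiding_walk (x, y) x y"
proof
  assume "avoiding_walk (x, y) x y"
  then obtain p where p: "S.apath x p y" "(x, y) \<notin> set p" "(y, x) \<notin> set p"
    by (auto elim: avoiding_walk_apath)
  have yx: "(y, x) \<in> parcs (mk_symmetric D)" using e by (auto simp: in_S_iff)
  have "x \<noteq> y" using e no_loops' by auto
  have "2 \<le> length p"
  proof -
    have "p \<noteq> []" using p \<open>x \<noteq> y\<close> by (auto simp: S.apath_simps)
    moreover have False if "p = [e]" for e
      using that p by (cases e) (auto simp: S.apath_simps)
    ultimately show ?thesis by (cases p rule: remdups_adj.cases) auto
  qed
  moreover have "S.awalk y ((y, x) # p) y"
    using p yx S.wellformed' by (auto simp: S.awalk_simps S.apath_def)
  moreover have "distinct (tl (S.awalk_verts y ((y, x) # p)))"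
    using p by (auto simp: S.apath_def)
  ultimately have "is_cycle D (traversed_edges D ((y, x) # p))"
    unfolding is_cycle_conv
    by (intro exI[of _ "(y, x) # p"] exI[of _ y] conjI) auto
  moreover have "(x, y) \<in> traversed_edges D ((y, x) # p) \<or> (y, x) \<in> traversed_edges D ((y, x) # p)"
    using e by (auto simp: traversed_edges_def)
  ultimately show False using nocyc by blast
qed

text \<open>Walking around \<open>C\<close> never uses an arc outside \<open>C\<close>, and every
  vertex of \<open>C\<close> is reached from the starting point of the closed walk.\<close>

lemma avoiding_walk_on_cycle:
  assumes C: "is_cycle D C" and e: "e \<in> parcs D" "e \<notin> C"
    and uv: "u \<in> verts_of C" "v \<in> verts_of C"
  shows "avoiding_walk e u v"
proof -
  obtain p a where p: "S.awalk a p a" "C = traversed_edges D p"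
    using C by (auto simp: is_cycle_conv)
  have e_p: "e \<notin> set p" "prod.swap e \<notin> set p"
    using e p(2) by (auto simp: traversed_edges_def)
  have "z \<in> set (S.awalk_verts a p)" if z: "z \<in> verts_of C" for z
  proof -
    obtain f where f: "f \<in> set p" "z \<in> {fst f, snd f}"
      using z by (force simp: p(2) verts_of_def traversed_edges_def)
    then show ?thesis
      using S.awalk_verts_arc1[OF f(1)] S.awalk_verts_arc2[of a p a f] p(1) by auto
  qed
  with uv have "avoiding_walk e a u" "avoiding_walk e a v"
    using avoiding_walk_in_path[OF p(1) e_p] by auto
  then show ?thesis
    by (metis avoiding_walk_sym avoiding_walk_trans)
qed

text \<open>Asking for one reachable vertex is enough: for an arc \<open>e\<close> outside
  \<open>C\<close>, all other vertices of \<open>C\<close> are then reachable around the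
  cycle.\<close>

definition cycle_on_side :: "'v \<times> 'v \<Rightarrow> 'v \<Rightarrow> ('v \<times> 'v) set \<Rightarrow> bool" where
  "cycle_on_side e a C \<longleftrightarrow> is_cycle D C \<and> (\<exists>v \<in> verts_of C. avoiding_walk e a v)"

text \<open>A cycle on both sides would join the ends of the bridge without using it.\<close>

lemma cycle_sides_neq:
  assumes xy: "(x, y) \<in> parcs D"
    and nocyc: "\<And>C. is_cycle D C \<Longrightarrow> (x, y) \<notin> C \<and> (y, x) \<notin> C"
    and C: "cycle_on_side (x, y) x C" "cycle_on_side (x, y) y C'"
  shows "C \<noteq> C'"
proof
  assume "C = C'"
  with C obtain u v where uv: "u \<in> verts_of C" "v \<in> verts_of C"
    "avoiding_walk (x, y) x u" "avoiding_walk (x, y) y v" and "is_cycle D C"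
    by (auto simp: cycle_on_side_def)
  then have "avoiding_walk (x, y) u v"
    using avoiding_walk_on_cycle xy nocyc by metis
  with uv have "avoiding_walk (x, y) x y"
    by (metis avoiding_walk_sym avoiding_walk_trans)
  with not_avoiding_walk_ends nocyc xy show False by blast
qed

text \<open>The path runs from \<open>C\<close> to \<open>x\<close>, over the bridge, and from
  \<open>y\<close> to \<open>C'\<close>. The two outer pieces avoid the bridge and are disjoint,
  since a common vertex would join \<open>x\<close> to \<open>y\<close> without it.\<close>

lemma connecting_path_across:
  assumes xy: "(x, y) \<in> parcs D"
    and nocyc: "\<And>C. is_cycle D C \<Longrightarrow> (x, y) \<notin> C \<and> (y, x) \<notin> C"
    and C: "cycle_on_side (x, y) x C" "cycle_on_side (x, y) y C'"
  shows "\<exists>P. connecting_path D C P C' \<and> (x, y) \<in> traversed_edges D P"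
proof -
  obtain u v where uv: "u \<in> verts_of C" "v \<in> verts_of C'"
    and walks: "avoiding_walk (x, y) u x" "avoiding_walk (x, y) y v"
    using C avoiding_walk_sym by (auto simp: cycle_on_side_def)
  obtain p where p: "S.apath u p x" "(x, y) \<notin> set p" "prod.swap (x, y) \<notin> set p"
    using walks(1) by (rule avoiding_walk_apath)
  obtain q where q: "S.apath y q v" "(x, y) \<notin> set q" "prod.swap (x, y) \<notin> set q"
    using walks(2) by (rule avoiding_walk_apath)
  have disj: False if "z \<in> set (S.awalk_verts u p)" "z \<in> set (S.awalk_verts y q)" for z
  proof -
    have "avoiding_walk (x, y) u z" "avoiding_walk (x, y) y z"
      using avoiding_walk_in_path that p q S.awalkI_apath by blast+
    with walks(1) have "avoiding_walk (x, y) x y"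
      by (metis avoiding_walk_sym avoiding_walk_trans)
    with not_avoiding_walk_ends nocyc xy show False by blast
  qed
  have x: "x \<in> set (S.awalk_verts u p)"
    using S.awalkI_apath[OF p(1)] by (metis S.awalkE last_in_set S.awalk_verts_non_Nil)
  have last: "last (S.awalk_verts u p) = x" using S.awalkI_apath[OF p(1)] by auto
  have xy_q: "S.apath x ((x, y) # q) v"
    using q xy disj x by (auto simp: S.apath_Cons_iff in_S_iff)
  have "S.apath u (p @ (x, y) # q) v"
    unfolding S.apath_append_iff last using p(1) xy_q disj by auto
  then have "connecting_path D C (p @ (x, y) # q) C'"
    using uv by (auto simp: connecting_path_def)
  with xy show ?thesis by (auto simp: traversed_edges_def)
qed


text \<open>A path in the support that starts across the edge from \<open>x\<close> to
  \<open>y\<close> can be continued to a cycle, as the support has no leaves.\<close>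

lemma ex_cycle_on_side:
  assumes h: "kernel_vector h" and e: "(x, y) \<in> supp h \<or> (y, x) \<in> supp h"
    and nocyc: "\<And>C. is_cycle D C \<Longrightarrow> (x, y) \<notin> C \<and> (y, x) \<notin> C"
  shows "\<exists>K. cycle_on_side (x, y) y K \<and> K \<subseteq> supp h"
proof -
  have "supp h \<subseteq> parcs D" by (auto simp: supp_def)
  from ex_cycle_beyond[OF this ex_other_supp_arc[OF h], of x y] e
  obtain K p v where K: "is_cycle D K" "K \<subseteq> supp h" "v \<in> verts_of K"
    and p: "S.apath x ((x, y) # p) v"
    by auto
  then have "S.apath y p v" "x \<notin> set (S.awalk_verts y p)"
    by (auto simp: S.apath_Cons_iff)
  \<comment> \<open>Using the edge again would revisit \<open>x\<close>.\<close>
  moreover have "(x, y) \<notin> set p" "(y, x) \<notin> set p"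
    using S.awalk_verts_arc1[of "(x, y)" p y] S.awalk_verts_arc2[of y p v "(y, x)"] calculation
    by (auto simp: S.apath_def)
  ultimately have "avoiding_walk (x, y) y v"
    by (auto simp: avoiding_walk_def S.apath_def)
  with K show ?thesis by (auto simp: cycle_on_side_def)
qed

text \<open>Here the edge is outside the support, so any path within the support avoids it, and it
  suffices to start at \<open>y\<close> with the support arc \<open>f\<close>.\<close>

lemma ex_cycle_on_side_neighbour:
  assumes h: "kernel_vector h" and e: "(x, y) \<notin> supp h" "(y, x) \<notin> supp h"
    and f: "f \<in> supp h" "y \<in> {fst f, snd f}"
  shows "\<exists>K. cycle_on_side (x, y) y K \<and> K \<subseteq> supp h"
proof -
  obtain z where "(y, z) \<in> supp h \<union> (supp h)\<inverse>"
    using f by (cases f) auto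
  moreover have "supp h \<subseteq> parcs D" by (auto simp: supp_def)
  ultimately obtain K p v where K: "is_cycle D K" "K \<subseteq> supp h" "v \<in> verts_of K"
    and p: "S.apath y ((y, z) # p) v" "set ((y, z) # p) \<subseteq> supp h \<union> (supp h)\<inverse>"
    using ex_cycle_beyond[OF _ ex_other_supp_arc[OF h], of y z] by blast
  have "(x, y) \<notin> set ((y, z) # p)" "(y, x) \<notin> set ((y, z) # p)"
    using p(2) e by auto
  then have "avoiding_walk (x, y) y v"
    using p(1) unfolding avoiding_walk_def S.apath_def by auto
  with K show ?thesis by (auto simp: cycle_on_side_def)
qed

section \<open>Bounds between two kernel vectors\<close>

text \<open>If only one cycle \<open>K\<close> lies beyond the edge, then \<open>c\<close> and
  \<open>g\<close> have the same ratio at \<open>e\<close> and at the arcs around \<open>y\<close>.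
  Some such arc has a positive value of \<open>g\<close>, where \<open>c\<close> is at least as
  large; so the ratio is at least 1, which for the negative value at \<open>e\<close> gives the
  bound.\<close>

lemma unique_cycle_on_side_bound:
  assumes c: "kernel_vector c" and g: "kernel_vector g"
    and le: "\<And>f. f \<in> parcs D \<Longrightarrow> 0 < g f \<Longrightarrow> g f \<le> c f"
    and e: "e \<in> parcs D" "e = (x, y) \<or> e = (y, x)" "g e < 0"
    and nocyc: "\<And>C. is_cycle D C \<Longrightarrow> (x, y) \<notin> C \<and> (y, x) \<notin> C"
    and unique: "\<And>C C'. cycle_on_side (x, y) y C \<Longrightarrow> cycle_on_side (x, y) y C' \<Longrightarrow> C = C'"
  shows "c e \<le> g e"
proof -
  obtain K where K: "cycle_on_side (x, y) y K" "K \<subseteq> supp g"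
    using ex_cycle_on_side[OF g _ nocyc] e by (auto simp: supp_def)
  have "K \<noteq> {}"
    using K(1) by (auto simp: cycle_on_side_def verts_of_def)
  then obtain f where f: "f \<in> K" by blast
  with K(2) have gf: "g f \<noteq> 0" by (auto simp: supp_def)
  \<comment> \<open>The combination of \<open>c\<close> and \<open>g\<close> that vanishes at the
    chosen arc \<open>f\<close> of \<open>K\<close>.\<close>
  define d where "d = (\<lambda>a. g f * c a - c f * g a)"
  have d: "kernel_vector d"
    unfolding d_def using c g by (rule kernel_vector_lin)
  \<comment> \<open>The only candidate is \<open>K\<close>, which contains \<open>f\<close>, an arc
    outside the support of \<open>d\<close>. Hence \<open>d\<close> vanishes wherever a nonzero
    value would produce a cycle on this side: first at \<open>e\<close>, then at the arcs at
    \<open>y\<close>.\<close>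
  have d_cycle: False if "cycle_on_side (x, y) y K'" "K' \<subseteq> supp d" for K'
    using unique[OF K(1) that(1)] that(2) f by (auto simp: supp_def d_def)
  have e_d: "(x, y) \<notin> supp d" "(y, x) \<notin> supp d"
    using ex_cycle_on_side[OF d _ nocyc] d_cycle by blast+
  then have "d e = 0" using e by (auto simp: supp_def)
  obtain h where h: "h \<in> parcs D" "y \<in> {fst h, snd h}" "g h > 0"
    using ex_neighbour_pos[OF g e(1,3), of y] e(2) by auto
  have "d h = 0"
    using ex_cycle_on_side_neighbour[OF d e_d _ h(2)] d_cycle h(1) by (auto simp: supp_def)
  have "g f * c e = c f * g e" "g f * c h = c f * g h"
    using \<open>d e = 0\<close> \<open>d h = 0\<close> by (simp_all add: d_def)
  \<comment> \<open>The unknown ratio is eliminated by cross multiplication. The sign of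
    \<open>g f\<close> is irrelevant, as this nonzero factor is cancelled from an equation.\<close>
  then have "g f * (c e * g h) = g f * (g e * c h)"
    by (metis mult.assoc mult.left_commute)
  with gf have "c e * g h = g e * c h" by simp
  also have "\<dots> \<le> g e * g h"
    using le[OF h(1,3)] e(3) by (simp add: mult_left_mono_neg)
  finally show ?thesis using h(3) by simp
qed

text \<open>At a vertex of degree 2 the balance equation has just two terms, so the value at
  \<open>e\<close> is a fixed negative multiple of the value at the other arc \<open>h\<close>, for
  \<open>c\<close> as for \<open>g\<close>.\<close>

lemma degree_2_bound:
  assumes c: "kernel_vector c" and g: "kernel_vector g"
    and le: "\<And>f. f \<in> parcs D \<Longrightarrow> 0 < g f \<Longrightarrow> g f \<le> c f"
    and e: "e \<in> parcs D" "g e < 0" and deg: "incident_to_degree_2 D e"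
  shows "c e \<le> g e"
proof -
  obtain v where v: "v \<in> {fst e, snd e}" "vertex_degree D v = 2"
    using deg by (auto simp: incident_to_degree_2_def)
  define A where "A = {a \<in> parcs D. v \<in> {fst a, snd a}}"
  have "card A = 2"
  proof -
    have "A = in_arcs D v \<union> out_arcs D v"
      by (auto simp: A_def in_arcs_def out_arcs_def)
    moreover have "in_arcs D v \<inter> out_arcs D v = {}"
      using no_loops by (auto simp: in_arcs_def out_arcs_def)
    ultimately show ?thesis
      using v(2) finite_in_arcs finite_out_arcs
      by (simp add: vertex_degree_def in_degree_def out_degree_def card_Un_disjoint)
  qed
  obtain h where h: "h \<in> parcs D" "v \<in> {fst h, snd h}" "g h > 0"
    using ex_neighbour_pos[OF g e v(1)] by blast
  have "{e, h} \<subseteq> A" "e \<noteq> h" using e h v(1) by (auto simp: A_def)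
  then have A: "A = {e, h}"
    using \<open>card A = 2\<close> by (metis card_2_iff doubleton_eq_iff insert_subset insertE singletonD)
  have bal: "int (coef e v) * k e + int (coef h v) * k h = 0" if "kernel_vector k" for k
  proof -
    have "(\<Sum>a\<in>A. int (coef a v) * k a) = (\<Sum>a\<in>parcs D. int (coef a v) * k a)"
    proof (rule sum.mono_neutral_left)
      show "\<forall>a\<in>parcs D - A. int (coef a v) * k a = 0"
        by (auto simp: A_def coef_eq)
    qed (auto simp: A_def pair_finite_arcs)
    with that show ?thesis
      using \<open>e \<noteq> h\<close> by (simp add: A kernel_vector_def)
  qed
  have "coef e v \<noteq> 0"
    using coef_eq_0_iff[OF e(1)] v(1) by blast
  then have pos: "int (coef e v) > 0" by simp
  have "int (coef e v) * c e = - (int (coef h v) * c h)"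
    using bal[OF c] by simp
  also have "\<dots> \<le> - (int (coef h v) * g h)"
    using le[OF h(1,3)] by (simp add: mult_left_mono)
  also have "\<dots> = int (coef e v) * g e"
    using bal[OF g] by simp
  finally show ?thesis using pos by simp
qed

text \<open>Either \<open>e\<close> has an end of degree 2, or it is a bridge with at most one cycle
  on one of its sides; each case has its own bound.\<close>

lemma kernel_vector_bound:
  assumes cycle_edges: "\<And>C e. \<lbrakk>is_cycle D C; e \<in> C\<rbrakk> \<Longrightarrow> incident_to_degree_2 D e"
    and connecting_edges:
      "\<And>C1 C2 C3 P1 P2 e.
         \<lbrakk>is_cycle D C1; is_cycle D C2; is_cycle D C3;
          C1 \<noteq> C2; C1 \<noteq> C3; C2 \<noteq> C3;
          connecting_path D C1 P1 C3; connecting_path D C2 P2 C3;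
          e \<in> traversed_edges D P1 \<inter> traversed_edges D P2\<rbrakk> \<Longrightarrow>
         incident_to_degree_2 D e \<or>
         ((\<forall>C. is_cycle D C \<and> C \<noteq> C3 \<longrightarrow> verts_of C3 \<inter> verts_of C = {}) \<and>
          \<not> (\<exists>C P. is_cycle D C \<and> C \<noteq> C3 \<and> connecting_path D C3 P C \<and>
                  e \<notin> traversed_edges D P))"
    and c: "kernel_vector c" and g: "kernel_vector g"
    and le: "\<And>f. f \<in> parcs D \<Longrightarrow> 0 < g f \<Longrightarrow> g f \<le> c f"
    and e: "e \<in> parcs D" "g e < 0"
  shows "c e \<le> g e"
proof (cases "incident_to_degree_2 D e")
  case True
  with c g le e show ?thesis by (rule degree_2_bound)
next
  case False
  obtain x y where xy: "e = (x, y)" by force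
  have nocyc: "(x, y) \<notin> C \<and> (y, x) \<notin> C" if "is_cycle D C" for C
    using cycle_edges[OF that] False e(1) no_opposite_arcs that
    by (auto simp: xy is_cycle_def traversed_edges_def)
  have nocyc': "(y, x) \<notin> C \<and> (x, y) \<notin> C" if "is_cycle D C" for C
    using nocyc[OF that] by blast
  \<comment> \<open>Deletion of an edge ignores its direction, so the bound for the side of
    \<open>y\<close> serves the side of \<open>x\<close> as well.\<close>
  have side_swap: "cycle_on_side (y, x) = cycle_on_side (x, y)"
    using avoiding_walk_swap[of "(x, y)"] by (auto simp: cycle_on_side_def fun_eq_iff)
  \<comment> \<open>With two cycles on each side, the paths from \<open>C1\<close> and
    \<open>C2\<close> to \<open>C3\<close> both cross \<open>e\<close>, so condition (ii) must hold
    for \<open>C3\<close>. But \<open>C4\<close> is reached from \<open>C3\<close> on the same side,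
    by a path that avoids \<open>e\<close>.\<close>
  have "C1 = C2 \<or> C3 = C4"
    if C12: "cycle_on_side (x, y) x C1" "cycle_on_side (x, y) x C2"
      and C34: "cycle_on_side (x, y) y C3" "cycle_on_side (x, y) y C4" for C1 C2 C3 C4
  proof (rule ccontr)
    assume neq: "\<not> (C1 = C2 \<or> C3 = C4)"
    have e': "(x, y) \<in> parcs D" using e(1) by (simp add: xy)
    obtain P1 P2 where P: "connecting_path D C1 P1 C3" "e \<in> traversed_edges D P1"
        "connecting_path D C2 P2 C3" "e \<in> traversed_edges D P2"
      using connecting_path_across[OF e' nocyc C12(1) C34(1)]
        connecting_path_across[OF e' nocyc C12(2) C34(1)] by (auto simp: xy)
    have "C1 \<noteq> C3" "C2 \<noteq> C3"
      using cycle_sides_neq[OF e' nocyc C12(1) C34(1)] cycle_sides_neq[OF e' nocyc C12(2) C34(1)]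
      by auto
    moreover have cyc: "is_cycle D C1" "is_cycle D C2" "is_cycle D C3" "is_cycle D C4"
      using C12 C34 by (auto simp: cycle_on_side_def)
    ultimately have no_path: "\<not> (connecting_path D C3 P C4 \<and> e \<notin> traversed_edges D P)" for P
      using connecting_edges[of C1 C2 C3 P1 P2 e] P neq False by blast
    obtain u v where uv: "u \<in> verts_of C3" "v \<in> verts_of C4"
      "avoiding_walk (x, y) y u" "avoiding_walk (x, y) y v"
      using C34 by (auto simp: cycle_on_side_def)
    then have "avoiding_walk (x, y) u v"
      by (metis avoiding_walk_sym avoiding_walk_trans)
    then obtain P where "S.apath u P v" "(x, y) \<notin> set P" "prod.swap (x, y) \<notin> set P"
      by (rule avoiding_walk_apath)
    with uv no_path[of P] show False
      by (auto simp: connecting_path_def traversed_edges_def xy)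
  qed
  then consider
      "\<And>C C'. cycle_on_side (x, y) x C \<Longrightarrow> cycle_on_side (x, y) x C' \<Longrightarrow> C = C'"
    | "\<And>C C'. cycle_on_side (x, y) y C \<Longrightarrow> cycle_on_side (x, y) y C' \<Longrightarrow> C = C'"
    by blast
  then show ?thesis
  proof cases
    case 1
    show ?thesis
      by (rule unique_cycle_on_side_bound[OF c g le e(1) _ e(2) nocyc'])
        (use 1 xy side_swap in auto)
  next
    case 2
    show ?thesis
      by (rule unique_cycle_on_side_bound[OF c g le e(1) _ e(2) nocyc]) (use 2 xy in auto)
  qed
qed

end

section \<open>Strong robustness of the toric ideal\<close>

theorem theorem3p11:
  fixes D :: "'v pair_pre_digraph" and w :: "'v \<Rightarrow> nat"
  assumes "weighted_oriented_graph D w"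
    and no_shared_path:
      "\<And>C C'. \<lbrakk>is_cycle D C; is_cycle D C'; C \<noteq> C'\<rbrakk> \<Longrightarrow> C \<inter> C' = {}"
    and cycle_edges:
      "\<And>C e. \<lbrakk>is_cycle D C; e \<in> C\<rbrakk> \<Longrightarrow> incident_to_degree_2 D e"
    and connecting_edges:
      "\<And>C1 C2 C3 P1 P2 e.
         \<lbrakk>is_cycle D C1; is_cycle D C2; is_cycle D C3;
          C1 \<noteq> C2; C1 \<noteq> C3; C2 \<noteq> C3;
          connecting_path D C1 P1 C3; connecting_path D C2 P2 C3;
          e \<in> traversed_edges D P1 \<inter> traversed_edges D P2\<rbrakk> \<Longrightarrow>
         incident_to_degree_2 D e \<or>
         ((\<forall>C. is_cycle D C \<and> C \<noteq> C3 \<longrightarrow> verts_of C3 \<inter> verts_of C = {}) \<and>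
          \<not> (\<exists>C P. is_cycle D C \<and> C \<noteq> C3 \<and> connecting_path D C3 P C \<and>
                  e \<notin> traversed_edges D P))"
  shows "strongly_robust (poly_ring (parcs D))
           (toric_ideal D w :: ('v \<times> 'v, 'k::field) mpoly set)"
proof -
  interpret weighted_oriented_graph D w by fact
  let ?l = "Poly_Mapping.lookup :: ('v \<times> 'v \<Rightarrow>\<^sub>0 nat) \<Rightarrow> 'v \<times> 'v \<Rightarrow> nat"
  let ?prim = "\<lambda>u v. primitive_binomial (toric_ideal D w)
    (monomial u - monomial v :: ('v \<times> 'v, 'k) mpoly)"
  \<comment> \<open>Equality of the two images under \<open>exponent_map\<close>, read at each
    vertex, is the balance equation for \<open>u - v\<close>.\<close>
  have kernel: "kernel_vector (\<lambda>e. int (?l u e) - int (?l v e))" if uv: "?prim u v" for u v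
  proof -
    have "(\<Sum>e\<in>parcs D. int (coef e x) * (int (?l u e) - int (?l v e))) = 0" for x
    proof -
      have "(\<Sum>e\<in>parcs D. ?l u e * coef e x) = (\<Sum>e\<in>parcs D. ?l v e * coef e x)"
        using primitive_toric_binomialD[OF uv]
        by (simp flip: lookup_exponent_map[OF pair_finite_arcs])
      then have "int (\<Sum>e\<in>parcs D. ?l u e * coef e x) = int (\<Sum>e\<in>parcs D. ?l v e * coef e x)"
        by simp
      then show ?thesis
        by (simp add: right_diff_distrib sum_subtractf mult.commute)
    qed
    then show ?thesis by (simp add: kernel_vector_def)
  qed
  show ?thesis
  proof (rule strongly_robust_toric_idealI)
    fix u v u' v' e
    assume uv: "?prim u v" and uv': "?prim u' v'" and le: "\<And>e. ?l u' e \<le> ?l u e"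
    show "?l v' e \<le> ?l v e"
    proof (cases "?l v' e = 0")
      case False
      then have e: "e \<in> parcs D" "?l u' e = 0"
        using primitive_toric_binomialD(4)[OF uv'] primitive_toric_binomial_disjoint[OF uv', of e]
        by (auto simp: in_keys_iff)
      \<comment> \<open>At \<open>e\<close> the vector of the smaller pair is negative, with value
        minus \<open>v' e\<close>. Disjointness of the supports turns divisibility of
        \<open>u\<close> by \<open>u'\<close> into the required bound on positive values.\<close>
      have "int (?l u e) - int (?l v e) \<le> int (?l u' e) - int (?l v' e)"
      proof (rule kernel_vector_bound[OF cycle_edges connecting_edges kernel[OF uv] kernel[OF uv'] _ e(1)])
        show "int (?l u' f) - int (?l v' f) \<le> int (?l u f) - int (?l v f)"
          if "0 < int (?l u' f) - int (?l v' f)" for f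
          using that le[of f] primitive_toric_binomial_disjoint[OF uv, of f]
            primitive_toric_binomial_disjoint[OF uv', of f] by auto
      qed (use False e(2) in auto)
      with e(2) show ?thesis by linarith
    qed simp
  qed
qed

end
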